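(* Let $A,B$ be zonoids in $\mathbb{R}^3$ with $|\partial A|>0$. Then $$\frac{|A+B|}{|\partial(A+B)|}\ge\frac{|A|}{|\partial A|}.$$
   Context: A zonotope is a finite Minkowski sum of segments; a zonoid is a limit of zonotopes in the Hausdorff metric. $|\cdot|$ is 3-dimensional volume, $+$ is Minkowski sum. $|\partial K|$ is the surface area of $K$, i.e. $|\partial K|=3V(K,K,B_2^3)$, where $V$ is the mixed volume normalized by $V(K,K,K)=|K|$ and $B_2^3$ is the closed Euclidean unit ball. *)

theory Defs
  imports "HOL-Analysis.Analysis" "HOL-Library.Set_Algebras"
begin

definition zonotope :: "'a::euclidean_space set \<Rightarrow> bool" where
  "zonotope Z \<longleftrightarrow>
     (\<exists>(n::nat) a b. n > 0 \<and> Z = (\<Sum>i<n. closed_segment (a i) (b i)))"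

text \<open>The library has no Hausdorff distance.  The formula below is the usual one; it is
  meaningful on nonempty bounded sets, where the suprema are finite.\<close>

definition hausdorff_dist :: "'a::metric_space set \<Rightarrow> 'a set \<Rightarrow> real" where
  "hausdorff_dist S T = max (SUP x\<in>S. infdist x T) (SUP y\<in>T. infdist y S)"

text \<open>Limits are taken in the metric space of nonempty compact sets.\<close>

definition zonoid :: "'a::euclidean_space set \<Rightarrow> bool" where
  "zonoid K \<longleftrightarrow>
     compact K \<and> K \<noteq> {} \<and>
     (\<exists>Z. (\<forall>n. zonotope (Z n)) \<and> (\<lambda>n. hausdorff_dist (Z n) K) \<longlonglongrightarrow> 0)"

abbreviation vol :: "(real^3) set \<Rightarrow> real" where
  "vol K \<equiv> measure lebesgue K"

text \<open>By Minkowski's theorem, the volume of \<open>t\<^sub>0 K + t\<^sub>1 L + t\<^sub>2 M\<close> is, for convex bodies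
  and nonnegative scalars, a homogeneous cubic polynomial; the mixed volume is its
  symmetric coefficient at indices 0, 1, 2.  That value is determined by the polynomial,
  and all three bodies may coincide, in which case it is the volume.  The outer set sum
  below is a Minkowski sum.\<close>

definition mixed_volume :: "(real^3) set \<Rightarrow> (real^3) set \<Rightarrow> (real^3) set \<Rightarrow> real" where
  "mixed_volume K L M = (THE v.
     \<exists>c :: nat \<Rightarrow> nat \<Rightarrow> nat \<Rightarrow> real.
       (\<forall>i j k. c i j k = c j i k \<and> c i j k = c i k j) \<and>
       (\<forall>t :: nat \<Rightarrow> real. (\<forall>i. t i \<ge> 0) \<longrightarrow>
          vol (\<Sum>i<3. (\<lambda>x. t i *\<^sub>R x) ` ([K, L, M] ! i)) =
          (\<Sum>i<3. \<Sum>j<3. \<Sum>k<3. c i j k * t i * t j * t k)) \<and>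
       v = c 0 1 2)"

definition surface_area :: "(real^3) set \<Rightarrow> real" where
  "surface_area K = 3 * mixed_volume K K (cball 0 1)"

end

theory Submission
  imports Defs
begin

text \<open>
  The volume of a zonotope with generators \<open>v\<^sub>i\<close> is \<open>1/6 \<Sum> \<bar>det (v\<^sub>i, v\<^sub>j, v\<^sub>k)\<bar>\<close>, the sum
  running over all ordered triples: adding a segment changes the volume by an affine function of the
  length of the segment, so the volume is multiaffine in the lengths, and it is homogeneous of
  degree 3.  Hence log-submodularity \<open>\<bar>S + T + R\<bar> \<bar>S\<bar> \<le> \<bar>S + T\<bar> \<bar>S + R\<bar>\<close> of the volume of zonotopes
  reduces, one segment at a time, to
  \<open>2 \<Sum> \<bar>det (v\<^sub>i, v\<^sub>j, v\<^sub>k)\<bar> \<Sum> \<bar>det (v\<^sub>i, b, c)\<bar> \<le> 3 \<Sum> \<bar>det (v\<^sub>i, v\<^sub>j, b)\<bar> \<Sum> \<bar>det (v\<^sub>i, v\<^sub>j, c)\<bar>\<close>.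
  Projecting along \<open>b\<close> and \<open>c\<close> turns the \<open>v\<^sub>i\<close> into weighted points \<open>(x\<^sub>i, y\<^sub>i)\<close> of the plane.
  Bounding a triangle area by \<open>\<bar>y\<^sub>i - y\<^sub>j\<bar> \<bar>x\<^sub>j - x\<^sub>k\<bar> + \<bar>y\<^sub>j - y\<^sub>k\<bar> \<bar>x\<^sub>i - x\<^sub>j\<bar>\<close>, with \<open>j\<close> the middle index
  in the order of the \<open>x\<close>, what remains is that the distance covariance of \<open>x\<close> and \<open>y\<close> is nonnegative.

  Since the unit ball \<open>U\<close> is a limit of zonotopes, log-submodularity with \<open>R = t U\<close> and \<open>t \<rightarrow> 0\<close> yields
  \<open>\<bar>\<partial>(A + B)\<bar> \<bar>A\<bar> \<le> \<bar>A + B\<bar> \<bar>\<partial>A\<bar>\<close>, and volumes and surface areas pass to Hausdorff limits.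
\<close>

section \<open>Distance covariance on the line\<close>

text \<open>The metric of the line is a squared Euclidean distance. A new largest point
  \<open>b\<close> copies the coordinates of the old maximum \<open>p\<close> and receives one
  further coordinate \<open>sqrt (b - p)\<close>, which is 0 at all other points.\<close>

lemma abs_diff_sum_squares:
  fixes X :: "real set"
  assumes "finite X"
  shows "\<exists>(n::nat) u. \<forall>s\<in>X. \<forall>t\<in>X. \<bar>s - t\<bar> = (\<Sum>m<n. (u m s - u m t)\<^sup>2)"
  using assms
proof (induction X rule: finite_linorder_max_induct)
  case (insert b A)
  show ?case
  proof (cases "A = {}")
    case True
    then show ?thesis by (intro exI[of _ 0]) auto
  next
    case False
    obtain n :: nat and u where u: "\<And>s t. s \<in> A \<Longrightarrow> t \<in> A \<Longrightarrow> \<bar>s - t\<bar> = (\<Sum>m<n. (u m s - u m t)\<^sup>2)"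
      using insert.IH by blast
    define p where "p = Max A"
    have p: "p \<in> A" "\<And>a. a \<in> A \<Longrightarrow> a \<le> p"
      using insert.hyps False by (auto simp: p_def)
    have pb: "p < b" using p insert.hyps by auto
    define u' where "u' m s = (if m < n then u m (if s = b then p else s)
        else if s = b then sqrt (b - p) else 0)" for m s
    have main: "\<bar>s - t\<bar> = (\<Sum>m<Suc n. (u' m s - u' m t)\<^sup>2)" if s: "s \<in> insert b A" and t: "t \<in> insert b A" for s t
    proof -
      define s' t' where "s' = (if s = b then p else s)" and "t' = (if t = b then p else t)"
      have A: "s' \<in> A" "t' \<in> A" using s t p by (auto simp: s'_def t'_def)
      have "(\<Sum>m<n. (u' m s - u' m t)\<^sup>2) = \<bar>s' - t'\<bar>"
        unfolding u[OF A] by (intro sum.cong) (auto simp: u'_def s'_def t'_def)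
      moreover have "(u' n s - u' n t)\<^sup>2 = (if (s = b) = (t = b) then 0 else b - p)"
        using pb by (auto simp: u'_def)
      moreover have "\<bar>s - t\<bar> = \<bar>s' - t'\<bar> + (if (s = b) = (t = b) then 0 else b - p)"
        using p(2)[of s] p(2)[of t] pb s t by (auto simp: s'_def t'_def)
      ultimately show ?thesis by simp
    qed
    then show ?thesis by blast
  qed
qed auto

lemma abs_diff_sum_squares_family:
  fixes y :: "'i \<Rightarrow> real"
  assumes "finite I"
  obtains n :: nat and u where "\<And>i j. i \<in> I \<Longrightarrow> j \<in> I \<Longrightarrow> \<bar>y i - y j\<bar> = (\<Sum>m<n. (u m i - u m j)\<^sup>2)"
proof -
  obtain n :: nat and u where "\<forall>s\<in>y ` I. \<forall>t\<in>y ` I. \<bar>s - t\<bar> = (\<Sum>m<n. (u m s - u m t)\<^sup>2)"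
    using abs_diff_sum_squares[of "y ` I"] assms by blast
  then show ?thesis by (intro that[of "\<lambda>m i. u m (y i)" n]) auto
qed

text \<open>For a kernel \<open>(f i - f j)^2\<close> the pure squares drop out because the weights
  sum to 0, leaving -2 times the square of the sum of \<open>v i * f i\<close>. The absolute value
  is a sum of such kernels.\<close>

lemma abs_diff_negative_type:
  fixes y v :: "'i \<Rightarrow> real"
  assumes "finite I" "sum v I = 0"
  shows "(\<Sum>i\<in>I. \<Sum>j\<in>I. v i * v j * \<bar>y i - y j\<bar>) \<le> 0"
proof -
  obtain n :: nat and u where u: "\<And>i j. i \<in> I \<Longrightarrow> j \<in> I \<Longrightarrow> \<bar>y i - y j\<bar> = (\<Sum>m<n. (u m i - u m j)\<^sup>2)"
    using abs_diff_sum_squares_family[OF assms(1)] by blast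
  have sq: "(\<Sum>i\<in>I. \<Sum>j\<in>I. v i * v j * (f i - f j)\<^sup>2) = - 2 * (\<Sum>i\<in>I. v i * f i)\<^sup>2" for f :: "'i \<Rightarrow> real"
  proof -
    have "(\<Sum>i\<in>I. \<Sum>j\<in>I. v i * v j * (f i - f j)\<^sup>2)
       = (\<Sum>i\<in>I. \<Sum>j\<in>I. (v i * (f i)\<^sup>2) * v j + v i * (v j * (f j)\<^sup>2) - 2 * ((v i * f i) * (v j * f j)))"
      by (intro sum.cong refl) (simp add: power2_eq_square algebra_simps)
    also have "\<dots> = - 2 * ((\<Sum>i\<in>I. v i * f i) * (\<Sum>i\<in>I. v i * f i))"
      by (simp add: sum.distrib sum_subtractf sum_distrib_left[symmetric] sum_distrib_right[symmetric] assms(2))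
    finally show ?thesis by (simp add: power2_eq_square)
  qed
  have "(\<Sum>i\<in>I. \<Sum>j\<in>I. v i * v j * \<bar>y i - y j\<bar>) = (\<Sum>i\<in>I. \<Sum>j\<in>I. \<Sum>m<n. v i * v j * (u m i - u m j)\<^sup>2)"
    by (intro sum.cong refl) (simp add: u sum_distrib_left)
  also have "\<dots> = (\<Sum>m<n. \<Sum>i\<in>I. \<Sum>j\<in>I. v i * v j * (u m i - u m j)\<^sup>2)"
    by (simp add: sum.swap[of _ "{..<n}"])
  also have "\<dots> \<le> 0" unfolding sq by (intro sum_nonpos) auto
  finally show ?thesis .
qed

text \<open>Writing \<open>\<bar>x i - x j\<bar>\<close> as a sum of squares reduces the claim to kernels \<open>(u i - u j)\<^sup>2\<close>.
  For these the right-hand side minus the left-hand side is \<open>-2\<close> times the form of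
  \<open>abs_diff_negative_type\<close> in the centred vector \<open>v i = w i * (N * u i - U)\<close>.\<close>

lemma distance_covariance_nonneg:
  fixes w x y :: "'i \<Rightarrow> real"
  assumes fin: "finite I"
  shows "2 * sum w I * (\<Sum>i\<in>I. w i * (\<Sum>j\<in>I. w j * \<bar>x i - x j\<bar>) * (\<Sum>j\<in>I. w j * \<bar>y i - y j\<bar>))
    \<le> (\<Sum>i\<in>I. \<Sum>j\<in>I. w i * w j * \<bar>x i - x j\<bar>) * (\<Sum>i\<in>I. \<Sum>j\<in>I. w i * w j * \<bar>y i - y j\<bar>)
      + (sum w I)\<^sup>2 * (\<Sum>i\<in>I. \<Sum>j\<in>I. w i * w j * \<bar>x i - x j\<bar> * \<bar>y i - y j\<bar>)"
proof -
  define N where "N = sum w I"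
  define E where "E i j = \<bar>y i - y j\<bar>" for i j
  define e where "e i = (\<Sum>j\<in>I. w j * E i j)" for i
  define R where "R = (\<Sum>i\<in>I. w i * e i)"
  have Esym: "E i j = E j i" for i j by (auto simp: E_def)
  have R: "(\<Sum>i\<in>I. \<Sum>j\<in>I. w i * w j * E i j) = R"
    by (simp add: R_def e_def sum_distrib_left mult.assoc)
  have cut: "2 * N * (\<Sum>i\<in>I. w i * (\<Sum>j\<in>I. w j * (u i - u j)\<^sup>2) * e i)
    \<le> (\<Sum>i\<in>I. \<Sum>j\<in>I. w i * w j * (u i - u j)\<^sup>2) * R + N\<^sup>2 * (\<Sum>i\<in>I. \<Sum>j\<in>I. w i * w j * (u i - u j)\<^sup>2 * E i j)"
    for u :: "'i \<Rightarrow> real"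
  proof -
    \<comment> \<open>Once the square is expanded, every sum in the claim is a polynomial in these
      moments and in \<open>N\<close> and \<open>R\<close>.\<close>
    define U S Q1 Q2 Q where "U = (\<Sum>i\<in>I. w i * u i)" and "S = (\<Sum>i\<in>I. w i * (u i)\<^sup>2)"
      and "Q1 = (\<Sum>i\<in>I. w i * u i * e i)" and "Q2 = (\<Sum>i\<in>I. w i * (u i)\<^sup>2 * e i)"
      and "Q = (\<Sum>i\<in>I. \<Sum>j\<in>I. (w i * u i) * (w j * u j) * E i j)"
    have row: "(\<Sum>j\<in>I. w j * (u i - u j)\<^sup>2) = N * (u i)\<^sup>2 - 2 * U * u i + S" for i
    proof -
      have "(\<Sum>j\<in>I. w j * (u i - u j)\<^sup>2) = (\<Sum>j\<in>I. (u i)\<^sup>2 * w j - 2 * u i * (w j * u j) + w j * (u j)\<^sup>2)"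
        by (intro sum.cong refl) (simp add: power2_eq_square algebra_simps)
      then show ?thesis
        by (simp add: sum.distrib sum_subtractf sum_distrib_left[symmetric] N_def U_def S_def)
    qed
    have 1: "(\<Sum>i\<in>I. w i * (\<Sum>j\<in>I. w j * (u i - u j)\<^sup>2) * e i) = N * Q2 - 2 * U * Q1 + S * R"
    proof -
      have "(\<Sum>i\<in>I. w i * (\<Sum>j\<in>I. w j * (u i - u j)\<^sup>2) * e i)
         = (\<Sum>i\<in>I. N * (w i * (u i)\<^sup>2 * e i) - 2 * U * (w i * u i * e i) + S * (w i * e i))"
        unfolding row by (intro sum.cong refl) (simp add: algebra_simps)
      then show ?thesis
        by (simp add: sum.distrib sum_subtractf sum_distrib_left[symmetric] Q1_def Q2_def R_def)
    qed
    have 2: "(\<Sum>i\<in>I. \<Sum>j\<in>I. w i * w j * (u i - u j)\<^sup>2) = 2 * N * S - 2 * U\<^sup>2"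
    proof -
      have "(\<Sum>i\<in>I. \<Sum>j\<in>I. w i * w j * (u i - u j)\<^sup>2) = (\<Sum>i\<in>I. w i * (\<Sum>j\<in>I. w j * (u i - u j)\<^sup>2))"
        by (simp add: sum_distrib_left mult.assoc)
      also have "\<dots> = (\<Sum>i\<in>I. N * (w i * (u i)\<^sup>2) - 2 * U * (w i * u i) + S * w i)"
        unfolding row by (intro sum.cong refl) (simp add: algebra_simps)
      also have "\<dots> = N * S - 2 * U * U + S * N"
        by (simp add: sum.distrib sum_subtractf sum_distrib_left[symmetric] N_def U_def S_def)
      finally show ?thesis by (simp add: power2_eq_square)
    qed
    have sq1: "(\<Sum>i\<in>I. \<Sum>j\<in>I. w i * f i * w j * E i j) = (\<Sum>i\<in>I. w i * f i * e i)" for f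
      by (simp add: e_def sum_distrib_left mult.assoc)
    have sq2: "(\<Sum>i\<in>I. \<Sum>j\<in>I. w i * w j * f j * E i j) = (\<Sum>i\<in>I. w i * f i * e i)" for f
      unfolding sq1[symmetric] by (subst sum.swap) (simp add: Esym mult_ac)
    have 3: "(\<Sum>i\<in>I. \<Sum>j\<in>I. w i * w j * (u i - u j)\<^sup>2 * E i j) = 2 * Q2 - 2 * Q"
    proof -
      have "(\<Sum>i\<in>I. \<Sum>j\<in>I. w i * w j * (u i - u j)\<^sup>2 * E i j)
        = (\<Sum>i\<in>I. \<Sum>j\<in>I. w i * (u i)\<^sup>2 * w j * E i j + w i * w j * (u j)\<^sup>2 * E i j - 2 * ((w i * u i) * (w j * u j) * E i j))"
        by (intro sum.cong refl) (simp add: power2_eq_square algebra_simps)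
      then show ?thesis
        by (simp add: sum.distrib sum_subtractf sum_distrib_left[symmetric] sq1 sq2 Q2_def Q_def)
    qed
    define v where "v i = w i * (N * u i - U)" for i
    have "sum v I = (\<Sum>i\<in>I. N * (w i * u i) - U * w i)"
      unfolding v_def by (intro sum.cong refl) (simp add: algebra_simps)
    then have "sum v I = 0"
      by (simp add: sum_subtractf sum_distrib_left[symmetric] U_def N_def)
    then have "(\<Sum>i\<in>I. \<Sum>j\<in>I. v i * v j * E i j) \<le> 0"
      unfolding E_def by (rule abs_diff_negative_type[OF fin])
    moreover have "(\<Sum>i\<in>I. \<Sum>j\<in>I. v i * v j * E i j)
      = (\<Sum>i\<in>I. \<Sum>j\<in>I. N\<^sup>2 * ((w i * u i) * (w j * u j) * E i j) - N * U * (w i * u i * w j * E i j)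
         - N * U * (w i * w j * u j * E i j) + U\<^sup>2 * (w i * w j * E i j))"
      unfolding v_def by (intro sum.cong refl) (simp add: power2_eq_square algebra_simps)
    moreover have "\<dots> = N\<^sup>2 * Q - N * U * Q1 - N * U * Q1 + U\<^sup>2 * R"
      by (simp add: sum.distrib sum_subtractf sum_distrib_left[symmetric] sq1 sq2 R Q1_def Q_def)
    ultimately have "N\<^sup>2 * Q - 2 * (N * U * Q1) + U\<^sup>2 * R \<le> 0" by (simp add: mult_ac)
    then show ?thesis unfolding 1 2 3 by (simp add: power2_eq_square algebra_simps)
  qed
  obtain n :: nat and u where u: "\<And>i j. i \<in> I \<Longrightarrow> j \<in> I \<Longrightarrow> \<bar>x i - x j\<bar> = (\<Sum>m<n. (u m i - u m j)\<^sup>2)"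
    using abs_diff_sum_squares_family[OF fin] by blast
  have a: "(\<Sum>i\<in>I. w i * (\<Sum>j\<in>I. w j * \<bar>x i - x j\<bar>) * e i)
     = (\<Sum>m<n. \<Sum>i\<in>I. w i * (\<Sum>j\<in>I. w j * (u m i - u m j)\<^sup>2) * e i)"
  proof -
    have "(\<Sum>i\<in>I. w i * (\<Sum>j\<in>I. w j * \<bar>x i - x j\<bar>) * e i)
       = (\<Sum>i\<in>I. w i * (\<Sum>j\<in>I. \<Sum>m<n. w j * (u m i - u m j)\<^sup>2) * e i)"
      by (simp add: u sum_distrib_left cong: sum.cong)
    also have "\<dots> = (\<Sum>i\<in>I. \<Sum>m<n. w i * (\<Sum>j\<in>I. w j * (u m i - u m j)\<^sup>2) * e i)"
      by (subst sum.swap) (simp add: sum_distrib_left sum_distrib_right)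
    also have "\<dots> = (\<Sum>m<n. \<Sum>i\<in>I. w i * (\<Sum>j\<in>I. w j * (u m i - u m j)\<^sup>2) * e i)"
      by (rule sum.swap)
    finally show ?thesis .
  qed
  have b: "(\<Sum>i\<in>I. \<Sum>j\<in>I. w i * w j * \<bar>x i - x j\<bar> * g i j)
     = (\<Sum>m<n. \<Sum>i\<in>I. \<Sum>j\<in>I. w i * w j * (u m i - u m j)\<^sup>2 * g i j)" for g
  proof -
    have "(\<Sum>i\<in>I. \<Sum>j\<in>I. w i * w j * \<bar>x i - x j\<bar> * g i j)
      = (\<Sum>i\<in>I. \<Sum>j\<in>I. \<Sum>m<n. w i * w j * (u m i - u m j)\<^sup>2 * g i j)"
      by (intro sum.cong refl) (simp add: u sum_distrib_left sum_distrib_right)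
    then show ?thesis by (simp add: sum.swap[of _ "{..<n}"])
  qed
  define \<alpha> \<beta> \<gamma> where "\<alpha> m = (\<Sum>i\<in>I. w i * (\<Sum>j\<in>I. w j * (u m i - u m j)\<^sup>2) * e i)"
    and "\<beta> m = (\<Sum>i\<in>I. \<Sum>j\<in>I. w i * w j * (u m i - u m j)\<^sup>2)"
    and "\<gamma> m = (\<Sum>i\<in>I. \<Sum>j\<in>I. w i * w j * (u m i - u m j)\<^sup>2 * E i j)" for m
  \<comment> \<open>The inequality is linear in the kernel, so the cases of the single squares can
    be added up.\<close>
  have "(\<Sum>m<n. 2 * N * \<alpha> m) \<le> (\<Sum>m<n. \<beta> m * R + N\<^sup>2 * \<gamma> m)"
    unfolding \<alpha>_def \<beta>_def \<gamma>_def by (intro sum_mono cut)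
  then have "2 * N * sum \<alpha> {..<n} \<le> sum \<beta> {..<n} * R + N\<^sup>2 * sum \<gamma> {..<n}"
    by (simp only: sum.distrib sum_distrib_left sum_distrib_right)
  then have "2 * N * (\<Sum>i\<in>I. w i * (\<Sum>j\<in>I. w j * \<bar>x i - x j\<bar>) * e i)
    \<le> (\<Sum>i\<in>I. \<Sum>j\<in>I. w i * w j * \<bar>x i - x j\<bar>) * R
      + N\<^sup>2 * (\<Sum>i\<in>I. \<Sum>j\<in>I. w i * w j * \<bar>x i - x j\<bar> * E i j)"
    unfolding a b b[of "\<lambda>_ _. 1", simplified] \<alpha>_def \<beta>_def \<gamma>_def .
  then show ?thesis unfolding N_def e_def E_def R[symmetric] .
qed

text \<open>The bound on \<open>T\<close> is only used with the middle index between the other two in the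
  order of \<open>x\<close>; there it takes the symmetric form \<open>G\<close>, in which the sum over all triples
  reduces to the distance covariance.\<close>

lemma triple_sum_le:
  fixes w x y :: "'i \<Rightarrow> real" and T :: "'i \<Rightarrow> 'i \<Rightarrow> 'i \<Rightarrow> real"
  assumes fin: "finite I" and w: "\<And>i. i \<in> I \<Longrightarrow> w i \<ge> 0"
    and T: "\<And>i j k. i \<in> I \<Longrightarrow> j \<in> I \<Longrightarrow> k \<in> I \<Longrightarrow>
      T i j k \<le> w i * w j * w k * (\<bar>y i - y j\<bar> * \<bar>x j - x k\<bar> + \<bar>y j - y k\<bar> * \<bar>x i - x j\<bar>)"
    and sym: "\<And>i j k. T i j k = T j i k" "\<And>i j k. T i j k = T i k j"
  shows "2 * (\<Sum>i\<in>I. \<Sum>j\<in>I. \<Sum>k\<in>I. T i j k) * sum w I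
    \<le> 3 * ((\<Sum>i\<in>I. \<Sum>j\<in>I. w i * w j * \<bar>y i - y j\<bar>) * (\<Sum>i\<in>I. \<Sum>j\<in>I. w i * w j * \<bar>x i - x j\<bar>))"
proof -
  define N where "N = sum w I"
  have N: "N \<ge> 0" unfolding N_def using w by (simp add: sum_nonneg)
  \<comment> \<open>The last bracket is twice the distance from \<open>x k\<close> to the interval
    between \<open>x i\<close> and \<open>x j\<close>, so it vanishes when \<open>k\<close> is the
    middle index. The other two rotations then add up to exactly twice the bound on \<open>T\<close>
    at that middle index.\<close>
  define H where "H i j k = w i * w j * w k * (\<bar>y i - y j\<bar> * (\<bar>x i - x k\<bar> + \<bar>x j - x k\<bar> - \<bar>x i - x j\<bar>))" for i j k
  have G: "2 * T i j k \<le> H i j k + H i k j + H j k i" if I: "i \<in> I" "j \<in> I" "k \<in> I" for i j k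
  proof -
    define W where "W = w i * w j * w k"
    have b: "T i j k \<le> W * (\<bar>y i - y j\<bar> * \<bar>x j - x k\<bar> + \<bar>y j - y k\<bar> * \<bar>x i - x j\<bar>)"
            "T i j k \<le> W * (\<bar>y i - y j\<bar> * \<bar>x i - x k\<bar> + \<bar>y i - y k\<bar> * \<bar>x i - x j\<bar>)"
            "T i j k \<le> W * (\<bar>y i - y k\<bar> * \<bar>x j - x k\<bar> + \<bar>y j - y k\<bar> * \<bar>x i - x k\<bar>)"
      using T[OF I] T[of j i k] T[of i k j] I
      by (simp_all add: W_def sym abs_minus_commute mult_ac add_ac)
    have H: "H i j k + H i k j + H j k i
      = W * (\<bar>y i - y j\<bar> * (\<bar>x i - x k\<bar> + \<bar>x j - x k\<bar> - \<bar>x i - x j\<bar>)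
           + \<bar>y i - y k\<bar> * (\<bar>x i - x j\<bar> + \<bar>x j - x k\<bar> - \<bar>x i - x k\<bar>)
           + \<bar>y j - y k\<bar> * (\<bar>x i - x j\<bar> + \<bar>x i - x k\<bar> - \<bar>x j - x k\<bar>))"
      by (simp add: H_def W_def abs_minus_commute algebra_simps)
    \<comment> \<open>One of the three points lies between the other two: \<open>j\<close>,
      \<open>i\<close> or \<open>k\<close> in this order, matching the three bounds in
      \<open>b\<close>.\<close>
    consider "\<bar>x i - x k\<bar> = \<bar>x i - x j\<bar> + \<bar>x j - x k\<bar>" | "\<bar>x j - x k\<bar> = \<bar>x i - x j\<bar> + \<bar>x i - x k\<bar>"
      | "\<bar>x i - x j\<bar> = \<bar>x i - x k\<bar> + \<bar>x j - x k\<bar>" by linarith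
    then show ?thesis
    proof cases
      case 1
      show ?thesis using b(1) unfolding H 1 by (simp add: algebra_simps)
    next
      case 2
      show ?thesis using b(2) unfolding H 2 by (simp add: algebra_simps)
    next
      case 3
      show ?thesis using b(3) unfolding H 3 by (simp add: algebra_simps)
    qed
  qed
  define SH where "SH = (\<Sum>i\<in>I. \<Sum>j\<in>I. \<Sum>k\<in>I. H i j k)"
  have "2 * (\<Sum>i\<in>I. \<Sum>j\<in>I. \<Sum>k\<in>I. T i j k) \<le> (\<Sum>i\<in>I. \<Sum>j\<in>I. \<Sum>k\<in>I. H i j k + H i k j + H j k i)"
    unfolding sum_distrib_left by (intro sum_mono G)
  also have "\<dots> = 3 * SH"
  proof -
    have 1: "(\<Sum>i\<in>I. \<Sum>j\<in>I. \<Sum>k\<in>I. H i k j) = SH"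
      unfolding SH_def by (rule sum.cong[OF refl], rule sum.swap)
    have "(\<Sum>i\<in>I. \<Sum>j\<in>I. \<Sum>k\<in>I. H j k i) = (\<Sum>j\<in>I. \<Sum>i\<in>I. \<Sum>k\<in>I. H j k i)"
      by (rule sum.swap)
    also have "\<dots> = SH" unfolding SH_def by (rule sum.cong[OF refl], rule sum.swap)
    finally show ?thesis using 1 by (simp add: sum.distrib SH_def)
  qed
  finally have le: "2 * (\<Sum>i\<in>I. \<Sum>j\<in>I. \<Sum>k\<in>I. T i j k) \<le> 3 * SH" .
  define P where "P = (\<Sum>i\<in>I. w i * (\<Sum>j\<in>I. w j * \<bar>x i - x j\<bar>) * (\<Sum>j\<in>I. w j * \<bar>y i - y j\<bar>))"
  define Q where "Q = (\<Sum>i\<in>I. \<Sum>j\<in>I. w i * w j * \<bar>x i - x j\<bar> * \<bar>y i - y j\<bar>)"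
  have P1: "(\<Sum>i\<in>I. \<Sum>j\<in>I. \<Sum>k\<in>I. w i * w j * w k * (\<bar>y i - y j\<bar> * \<bar>x i - x k\<bar>)) = P"
    unfolding P_def
    by (rule sum.cong[OF refl], simp add: sum_distrib_left sum_distrib_right mult_ac, subst sum.swap, simp add: mult_ac)
  have P2: "(\<Sum>i\<in>I. \<Sum>j\<in>I. \<Sum>k\<in>I. w i * w j * w k * (\<bar>y i - y j\<bar> * \<bar>x j - x k\<bar>)) = P"
    unfolding P1[symmetric] by (subst sum.swap) (simp add: abs_minus_commute mult_ac)
  have Q1: "(\<Sum>i\<in>I. \<Sum>j\<in>I. \<Sum>k\<in>I. w i * w j * w k * (\<bar>y i - y j\<bar> * \<bar>x i - x j\<bar>)) = N * Q"
    unfolding Q_def N_def by (simp add: sum_distrib_left sum_distrib_right mult_ac)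
  have "SH = (\<Sum>i\<in>I. \<Sum>j\<in>I. \<Sum>k\<in>I. w i * w j * w k * (\<bar>y i - y j\<bar> * \<bar>x i - x k\<bar>)
     + w i * w j * w k * (\<bar>y i - y j\<bar> * \<bar>x j - x k\<bar>) - w i * w j * w k * (\<bar>y i - y j\<bar> * \<bar>x i - x j\<bar>))"
    unfolding SH_def H_def by (intro sum.cong refl) (simp add: algebra_simps)
  also have "\<dots> = 2 * P - N * Q"
    by (simp add: sum.distrib sum_subtractf P1 P2 Q1)
  finally have SH: "SH = 2 * P - N * Q" .
  \<comment> \<open>The factor \<open>N\<close> turns \<open>2 * P - N * Q\<close> into
    \<open>2 * N * P - N^2 * Q\<close>, which is what the distance covariance inequality
    bounds.\<close>
  have "2 * (\<Sum>i\<in>I. \<Sum>j\<in>I. \<Sum>k\<in>I. T i j k) * N \<le> 3 * SH * N"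
    by (rule mult_right_mono[OF le N])
  also have "\<dots> = 3 * (2 * N * P - N\<^sup>2 * Q)" by (simp add: SH power2_eq_square algebra_simps)
  also have "2 * N * P - N\<^sup>2 * Q \<le> (\<Sum>i\<in>I. \<Sum>j\<in>I. w i * w j * \<bar>x i - x j\<bar>) * (\<Sum>i\<in>I. \<Sum>j\<in>I. w i * w j * \<bar>y i - y j\<bar>)"
    using distance_covariance_nonneg[OF fin, of w x y] unfolding P_def Q_def N_def by linarith
  finally show ?thesis by (simp add: N_def mult_ac)
qed

section \<open>Determinant sums\<close>

definition det3 :: "real^3 \<Rightarrow> real^3 \<Rightarrow> real^3 \<Rightarrow> real" where
  "det3 a b c = a$1 * (b$2 * c$3 - b$3 * c$2) - a$2 * (b$1 * c$3 - b$3 * c$1) + a$3 * (b$1 * c$2 - b$2 * c$1)"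

lemma det3_swap: "det3 b a c = - det3 a b c" "det3 a c b = - det3 a b c"
  by (simp_all add: det3_def algebra_simps)

lemma abs_det3_swap: "\<bar>det3 a b c\<bar> = \<bar>det3 b a c\<bar>" "\<bar>det3 a b c\<bar> = \<bar>det3 a c b\<bar>"
  using det3_swap(1)[of a b c] det3_swap(2)[of a b c] by linarith+

lemma det3_scaleR: "det3 (t *\<^sub>R a) b c = t * det3 a b c" "det3 a (t *\<^sub>R b) c = t * det3 a b c"
    "det3 a b (t *\<^sub>R c) = t * det3 a b c"
  by (simp_all add: det3_def algebra_simps)

text \<open>All six determinants contain \<open>b\<close>. Modulo \<open>b\<close> they are 2 by 2
  determinants of \<open>a\<close>, \<open>c\<close>, \<open>v\<close>, \<open>w\<close>, and the
  identity is the three-term Pluecker relation.\<close>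

lemma det3_exchange: "det3 a b c * det3 b v w = det3 a b v * det3 b c w - det3 b c v * det3 a b w"
  unfolding det3_def by algebra

text \<open>Again a Pluecker relation modulo \<open>b\<close>. Divided by
  \<open>det3 u b c * det3 v b c\<close>, its right-hand side becomes a difference of a term in
  \<open>u\<close> and a term in \<open>v\<close>.\<close>

lemma det3_cramer_left: "det3 d b c * det3 u v b = det3 d b u * det3 v b c - det3 d b v * det3 u b c"
  unfolding det3_def by algebra

lemma det3_cramer_right: "det3 d b c * det3 u v c = det3 d c u * det3 v b c - det3 d c v * det3 u b c"
  using det3_cramer_left[of d c b u v] by (simp add: det3_swap(2)[of _ c b])

text \<open>Dividing each generator by \<open>z i\<close> places it in an affine plane at the point
  \<open>(X i, Y i)\<close> with weight \<open>\<bar>z i\<bar>\<close>. Determinants with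
  \<open>b\<close> or \<open>c\<close> become coordinate differences, and
  \<open>triple_sum_le\<close> applies.\<close>

lemma det3_sums_le_generic:
  fixes a :: "'i \<Rightarrow> real^3"
  assumes fin: "finite I" and nz: "\<And>i. i \<in> I \<Longrightarrow> det3 (a i) b c \<noteq> 0"
  shows "2 * (\<Sum>i\<in>I. \<Sum>j\<in>I. \<Sum>k\<in>I. \<bar>det3 (a i) (a j) (a k)\<bar>) * (\<Sum>i\<in>I. \<bar>det3 (a i) b c\<bar>)
    \<le> 3 * ((\<Sum>i\<in>I. \<Sum>j\<in>I. \<bar>det3 (a i) (a j) b\<bar>) * (\<Sum>i\<in>I. \<Sum>j\<in>I. \<bar>det3 (a i) (a j) c\<bar>))"
proof (cases "I = {}")
  case False
  then obtain i0 where i0: "i0 \<in> I" by auto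
  \<comment> \<open>Any generator can serve as the reference vector of the Cramer identities; only
    \<open>D \<noteq> 0\<close> matters.\<close>
  define d D where "d = a i0" and "D = det3 d b c"
  have D: "D \<noteq> 0" using nz[OF i0] by (simp add: D_def d_def)
  define z where "z i = det3 (a i) b c" for i
  define Y X where "Y i = det3 d b (a i) / (z i * D)" and "X i = det3 d c (a i) / (z i * D)" for i
  have yb: "\<bar>det3 (a i) (a j) b\<bar> = \<bar>z i\<bar> * \<bar>z j\<bar> * \<bar>Y i - Y j\<bar>" if "i \<in> I" "j \<in> I" for i j
  proof -
    have "det3 (a i) (a j) b = z i * z j * (Y i - Y j)"
      using det3_cramer_left[of d b c "a i" "a j"] nz[OF that(1)] nz[OF that(2)] D
      by (simp add: Y_def z_def D_def[symmetric] divide_simps) (simp add: algebra_simps)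
    then show ?thesis by (simp add: abs_mult)
  qed
  have xc: "\<bar>det3 (a i) (a j) c\<bar> = \<bar>z i\<bar> * \<bar>z j\<bar> * \<bar>X i - X j\<bar>" if "i \<in> I" "j \<in> I" for i j
  proof -
    have "det3 (a i) (a j) c = z i * z j * (X i - X j)"
      using det3_cramer_right[of d b c "a i" "a j"] nz[OF that(1)] nz[OF that(2)] D
      by (simp add: X_def z_def D_def[symmetric] divide_simps) (simp add: algebra_simps)
    then show ?thesis by (simp add: abs_mult)
  qed
  have T: "\<bar>det3 (a i) (a j) (a k)\<bar> \<le> \<bar>z i\<bar> * \<bar>z j\<bar> * \<bar>z k\<bar> * (\<bar>Y i - Y j\<bar> * \<bar>X j - X k\<bar> + \<bar>Y j - Y k\<bar> * \<bar>X i - X j\<bar>)"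
    if I: "i \<in> I" "j \<in> I" "k \<in> I" for i j k
  proof -
    \<comment> \<open>The exchange identity is taken around the middle vector \<open>a j\<close>;
      the extra factor \<open>\<bar>z j\<bar>\<close> is cancelled at the end.\<close>
    have "\<bar>det3 (a i) (a j) (a k)\<bar> * \<bar>z j\<bar>
      \<le> \<bar>det3 (a i) (a j) b\<bar> * \<bar>det3 (a j) (a k) c\<bar> + \<bar>det3 (a j) (a k) b\<bar> * \<bar>det3 (a i) (a j) c\<bar>"
      unfolding z_def abs_mult[symmetric] det3_exchange[of "a i" "a j" "a k" b c] by (rule abs_triangle_ineq4)
    also have "\<dots> = \<bar>z i\<bar> * \<bar>z j\<bar> * \<bar>z k\<bar> * (\<bar>Y i - Y j\<bar> * \<bar>X j - X k\<bar> + \<bar>Y j - Y k\<bar> * \<bar>X i - X j\<bar>) * \<bar>z j\<bar>"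
      by (simp add: yb xc I algebra_simps)
    finally show ?thesis using nz[OF I(2)] by (subst (asm) mult_le_cancel_right_pos) (simp_all add: z_def)
  qed
  have "2 * (\<Sum>i\<in>I. \<Sum>j\<in>I. \<Sum>k\<in>I. \<bar>det3 (a i) (a j) (a k)\<bar>) * (\<Sum>i\<in>I. \<bar>z i\<bar>)
    \<le> 3 * ((\<Sum>i\<in>I. \<Sum>j\<in>I. \<bar>z i\<bar> * \<bar>z j\<bar> * \<bar>Y i - Y j\<bar>) * (\<Sum>i\<in>I. \<Sum>j\<in>I. \<bar>z i\<bar> * \<bar>z j\<bar> * \<bar>X i - X j\<bar>))"
    by (rule triple_sum_le[OF fin abs_ge_zero T abs_det3_swap])
  then show ?thesis by (simp add: yb xc z_def cong: sum.cong)
qed simp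

text \<open>If all \<open>det3 (a i) b c\<close> vanish, the left side is 0. Otherwise shifting
  every generator by a small multiple of a suitable \<open>d\<close> reaches the generic case, and
  both sides are continuous in the shift.\<close>

lemma det3_sums_le:
  fixes a :: "'i \<Rightarrow> real^3"
  assumes fin: "finite I"
  shows "2 * (\<Sum>i\<in>I. \<Sum>j\<in>I. \<Sum>k\<in>I. \<bar>det3 (a i) (a j) (a k)\<bar>) * (\<Sum>i\<in>I. \<bar>det3 (a i) b c\<bar>)
    \<le> 3 * ((\<Sum>i\<in>I. \<Sum>j\<in>I. \<bar>det3 (a i) (a j) b\<bar>) * (\<Sum>i\<in>I. \<Sum>j\<in>I. \<bar>det3 (a i) (a j) c\<bar>))"
proof (cases "\<forall>i\<in>I. det3 (a i) b c = 0")
  case True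
  then show ?thesis by (simp add: sum_nonneg)
next
  case False
  then obtain d where d: "det3 d b c \<noteq> 0" by auto
  define f where "f e i = a i + e *\<^sub>R d" for e :: real and i
  define L where "L e = 2 * (\<Sum>i\<in>I. \<Sum>j\<in>I. \<Sum>k\<in>I. \<bar>det3 (f e i) (f e j) (f e k)\<bar>) * (\<Sum>i\<in>I. \<bar>det3 (f e i) b c\<bar>)" for e
  define R where "R e = 3 * ((\<Sum>i\<in>I. \<Sum>j\<in>I. \<bar>det3 (f e i) (f e j) b\<bar>) * (\<Sum>i\<in>I. \<Sum>j\<in>I. \<bar>det3 (f e i) (f e j) c\<bar>))" for e
  have "isCont L 0" "isCont R 0"
    unfolding L_def R_def f_def det3_def by (intro continuous_intros)+
  then have cont: "(L \<longlongrightarrow> L 0) (at 0)" "(R \<longlongrightarrow> R 0) (at 0)"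
    unfolding isCont_def .
  \<comment> \<open>The finitely many shifts that leave some generator degenerate. The value 0 may
    be among them, so the limit is taken in the punctured filter \<open>at 0\<close>.\<close>
  define B where "B = (\<lambda>i. - det3 (a i) b c / det3 d b c) ` I"
  have det: "det3 (f e i) b c = det3 (a i) b c + e * det3 d b c" for e i
    by (simp add: f_def det3_def algebra_simps)
  have fB: "finite B" using fin by (simp add: B_def)
  have "open (- (B - {0}))" using fB by (intro open_Compl finite_imp_closed) auto
  then have "\<forall>\<^sub>F e in at 0. e \<notin> B"
    unfolding eventually_at_topological by (intro exI[of _ "- (B - {0})"]) auto
  then have "\<forall>\<^sub>F e in at 0. L e \<le> R e"
  proof eventually_elim
    case (elim e)
    have "det3 (f e i) b c \<noteq> 0" if "i \<in> I" for i
      using elim that d by (force simp: det B_def field_simps eq_neg_iff_add_eq_0)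
    then show ?case unfolding L_def R_def by (rule det3_sums_le_generic[OF fin])
  qed
  then have "L 0 \<le> R 0"
    by (intro tendsto_le[OF _ cont(2) cont(1)]) auto
  then show ?thesis by (simp add: L_def R_def f_def)
qed

section \<open>Determinant sums over lists of generators and their log-submodularity\<close>

definition detsum :: "(real^3) list \<Rightarrow> (real^3) list \<Rightarrow> (real^3) list \<Rightarrow> real" where
  "detsum xs ys zs = (\<Sum>x\<leftarrow>xs. \<Sum>y\<leftarrow>ys. \<Sum>z\<leftarrow>zs. \<bar>det3 x y z\<bar>)"

text \<open>The volume of the zonotope generated by \<open>vs\<close>, as
  \<open>zonotope_of_vol\<close> confirms; ordered triples count each choice of three positions six
  times. In the same way \<open>detsum xs ys zs / 6\<close> is the mixed volume of three
  zonotopes.\<close>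

definition zvol :: "(real^3) list \<Rightarrow> real" where
  "zvol vs = detsum vs vs vs / 6"

lemma detsum_append:
  "detsum (xs @ xs') ys zs = detsum xs ys zs + detsum xs' ys zs"
  "detsum xs (ys @ ys') zs = detsum xs ys zs + detsum xs ys' zs"
  "detsum xs ys (zs @ zs') = detsum xs ys zs + detsum xs ys zs'"
  by (simp_all add: detsum_def sum_list_addf)

lemma sum_list_swap:
  fixes f :: "'a \<Rightarrow> 'b \<Rightarrow> 'c::comm_monoid_add"
  shows "(\<Sum>x\<leftarrow>xs. \<Sum>y\<leftarrow>ys. f x y) = (\<Sum>y\<leftarrow>ys. \<Sum>x\<leftarrow>xs. f x y)"
  by (induction xs) (simp_all add: sum_list_addf)

lemma detsum_swap: "detsum ys xs zs = detsum xs ys zs" "detsum xs zs ys = detsum xs ys zs"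
proof -
  show "detsum ys xs zs = detsum xs ys zs"
    unfolding detsum_def by (subst sum_list_swap) (subst det3_swap(1), simp)
  have "(\<Sum>y\<leftarrow>zs. \<Sum>z\<leftarrow>ys. \<bar>det3 x y z\<bar>) = (\<Sum>y\<leftarrow>ys. \<Sum>z\<leftarrow>zs. \<bar>det3 x y z\<bar>)" for x
    by (subst sum_list_swap) (subst det3_swap(2), simp)
  then show "detsum xs zs ys = detsum xs ys zs" by (simp add: detsum_def)
qed

lemma detsum_nonneg: "0 \<le> detsum xs ys zs"
  unfolding detsum_def by (intro sum_list_nonneg) (auto intro!: sum_list_nonneg)

lemma detsum_scaleR: "detsum (map ((*\<^sub>R) t) xs) ys zs = \<bar>t\<bar> * detsum xs ys zs"
  by (simp add: detsum_def det3_scaleR abs_mult sum_list_const_mult o_def)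

lemma detsum_mset: "mset xs = mset xs' \<Longrightarrow> detsum xs ys zs = detsum xs' ys zs"
  by (simp add: detsum_def flip: sum_mset_sum_list)

lemma zvol_mset: "mset xs = mset xs' \<Longrightarrow> zvol xs = zvol xs'"
proof -
  assume eq: "mset xs = mset xs'"
  \<comment> \<open>\<open>detsum_mset\<close> acts on the first slot, so the other slots are moved
    there by symmetry.\<close>
  have "detsum xs xs xs = detsum xs' xs xs" by (rule detsum_mset[OF eq])
  also have "\<dots> = detsum xs xs' xs" by (rule detsum_swap(1))
  also have "\<dots> = detsum xs' xs' xs" by (rule detsum_mset[OF eq])
  also have "\<dots> = detsum xs' xs xs'" by (rule detsum_swap(2))
  also have "\<dots> = detsum xs xs' xs'" by (rule detsum_swap(1))
  also have "\<dots> = detsum xs' xs' xs'" by (rule detsum_mset[OF eq])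
  finally show "zvol xs = zvol xs'" by (simp add: zvol_def)
qed

lemma zvol_nonneg: "0 \<le> zvol vs"
  by (simp add: zvol_def detsum_nonneg)

lemma zvol_append: "zvol (xs @ ys) = zvol xs + detsum xs xs ys / 2 + detsum xs ys ys / 2 + zvol ys"
proof -
  have "detsum ys xs xs = detsum xs xs ys" "detsum xs ys xs = detsum xs xs ys"
    "detsum ys xs ys = detsum xs ys ys" "detsum ys ys xs = detsum xs ys ys"
    by (simp_all add: detsum_swap(1)[of ys xs] detsum_swap(2)[of xs xs ys] detsum_swap(2)[of ys ys xs])
  then show ?thesis by (simp add: zvol_def detsum_append add_divide_distrib)
qed

text \<open>The volume polynomial of two zonotopes. Its coefficient at \<open>s\<^sup>2 * t\<close>
  is three times a mixed volume, which gives the surface area when \<open>ys\<close> approximates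
  the ball.\<close>

lemma zvol_combination:
  assumes "0 \<le> s" "0 \<le> t"
  shows "zvol (map ((*\<^sub>R) s) xs @ map ((*\<^sub>R) t) ys)
    = zvol xs * s ^ 3 + detsum xs xs ys / 2 * s\<^sup>2 * t + detsum xs ys ys / 2 * s * t\<^sup>2 + zvol ys * t ^ 3"
proof -
  have 2: "detsum xs (map ((*\<^sub>R) t) ys) zs = \<bar>t\<bar> * detsum xs ys zs" for t xs ys zs
    by (rule trans[OF detsum_swap(1)]) (simp add: detsum_scaleR detsum_swap(1)[of ys xs])
  have 3: "detsum xs ys (map ((*\<^sub>R) t) zs) = \<bar>t\<bar> * detsum xs ys zs" for t xs ys zs
    by (rule trans[OF detsum_swap(2)]) (simp add: 2 detsum_swap(2)[of xs zs ys])
  show ?thesis unfolding zvol_append using assms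
    by (simp add: zvol_def detsum_scaleR 2 3 power2_eq_square power3_eq_cube mult_ac)
qed

lemma zvol_mono_append: "zvol xs \<le> zvol (xs @ ys)"
  by (simp add: zvol_append detsum_nonneg zvol_nonneg)

text \<open>With \<open>V = zvol xs\<close> the four volumes are \<open>V + p + q + m\<close>,
  \<open>V\<close>, \<open>V + p\<close> and \<open>V + q\<close>, so the claim is
  \<open>m * V \<le> p * q\<close>. This is \<open>det3_sums_le\<close> up to constants.\<close>

lemma zvol_log_submodular_single: "zvol (xs @ [b, c]) * zvol xs \<le> zvol (xs @ [b]) * zvol (xs @ [c])"
proof -
  have I: "(\<Sum>x\<leftarrow>xs. f x) = (\<Sum>i<length xs. f (xs ! i))" for f :: "real^3 \<Rightarrow> real"
    by (simp add: sum_list_sum_nth atLeast0LessThan)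
  have key: "2 * detsum xs xs xs * detsum xs [b] [c] \<le> 3 * (detsum xs xs [b] * detsum xs xs [c])"
    using det3_sums_le[of "{..<length xs}" "\<lambda>i. xs ! i" b c] unfolding detsum_def I by simp
  have [simp]: "det3 x y y = 0" "det3 x x y = 0" "det3 x y x = 0" for x y
    by (simp_all add: det3_def algebra_simps)
  have one: "zvol (xs @ [d]) = zvol xs + detsum xs xs [d] / 2" for d
    by (simp add: zvol_append) (simp add: zvol_def detsum_def)
  have "detsum xs [b, c] [b, c] = detsum xs [b] [b] + detsum xs [b] [c] + detsum xs [c] [b] + detsum xs [c] [c]"
    using detsum_append(2)[of xs "[b]" "[c]"] detsum_append(3)[of xs _ "[b]" "[c]"] by simp
  also have "\<dots> = 2 * detsum xs [b] [c]"
    using detsum_swap(2)[of xs "[b]" "[c]"] by (simp add: detsum_def)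
  finally have "zvol (xs @ [b, c]) = zvol xs + (detsum xs xs [b] + detsum xs xs [c]) / 2 + detsum xs [b] [c]"
    using detsum_append(3)[of xs xs "[b]" "[c]"] by (simp add: zvol_append) (simp add: zvol_def detsum_def)
  then show ?thesis unfolding one using key by (simp add: zvol_def field_simps)
qed

text \<open>The case of single segments says that the ratio \<open>zvol (xs @ [c]) / zvol xs\<close>
  does not increase when \<open>xs\<close> gains a generator. Such ratios telescope, first along
  \<open>ys\<close> and then along \<open>zs\<close>.\<close>

lemma zvol_log_submodular: "zvol (xs @ ys @ zs) * zvol xs \<le> zvol (xs @ ys) * zvol (xs @ zs)"
proof -
  \<comment> \<open>Multiplies \<open>p / q \<le> u / r\<close> by \<open>q / s \<le> r / v\<close>
    in spirit, but without division: volumes may vanish, and \<open>r = 0\<close> forces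
    \<open>s = 0\<close>.\<close>
  have cancel: "p * s \<le> u * v" if "p * r \<le> u * q" "q * s \<le> r * v" "s \<le> r" "0 \<le> s" "0 \<le> u" "0 \<le> v"
    for p q r s u v :: real
  proof (cases "r = 0")
    case True
    then show ?thesis using that by auto
  next
    case False
    then have r: "r > 0" using that by auto
    have "(p * s) * r \<le> (u * q) * s"
      using mult_right_mono[OF that(1) that(4)] by (simp add: mult_ac)
    also have "\<dots> \<le> u * (r * v)"
      using mult_left_mono[OF that(2) that(5)] by (simp add: mult_ac)
    finally have "(p * s) * r \<le> (u * v) * r" by (simp add: mult_ac)
    then show ?thesis using r by simp
  qed
  have 1: "zvol (xs @ ys @ [c]) * zvol xs \<le> zvol (xs @ ys) * zvol (xs @ [c])" for xs ys c
  proof (induction ys rule: rev_induct)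
    case (snoc b ys)
    show ?case
      using cancel[OF zvol_log_submodular_single[of "xs @ ys" b c, simplified] snoc.IH] 
      by (simp add: zvol_mono_append zvol_nonneg)
  qed (simp add: mult.commute)
  \<comment> \<open>Each new generator \<open>c\<close> is compared over the base
    \<open>xs @ zs\<close>; permuting the generators leaves the volume unchanged.\<close>
  show ?thesis
  proof (induction zs rule: rev_induct)
    case (snoc c zs)
    have "zvol (xs @ zs @ ys @ [c]) = zvol (xs @ ys @ zs @ [c])"
      "zvol (xs @ zs @ ys) = zvol (xs @ ys @ zs)"
      by (rule zvol_mset, simp)+
    with 1[of "xs @ zs" ys c] have "zvol (xs @ ys @ zs @ [c]) * zvol (xs @ zs) \<le> zvol (xs @ zs @ [c]) * zvol (xs @ ys @ zs)"
      by (simp add: mult.commute)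
    moreover have "zvol (xs @ ys @ zs) * zvol xs \<le> zvol (xs @ zs) * zvol (xs @ ys)"
      using snoc.IH by (simp add: mult.commute)
    ultimately have "zvol (xs @ ys @ zs @ [c]) * zvol xs \<le> zvol (xs @ zs @ [c]) * zvol (xs @ ys)"
      by (rule cancel) (simp_all add: zvol_mono_append zvol_nonneg)
    then show ?case by (simp add: mult.commute)
  qed simp
qed

section \<open>Volume of zonotopes\<close>

lemma compact_plus: "compact S \<Longrightarrow> compact T \<Longrightarrow> compact (S + T)"
  for S T :: "'a::real_normed_vector set"
  unfolding set_plus_image case_prod_beta
  by (intro compact_continuous_image compact_Times continuous_intros)

lemma singleton_plus: "{p} + S = (+) p ` S"
  by (auto simp: set_plus_def)

lemma closed_segment_0_eq: "closed_segment 0 v = (\<lambda>r. r *\<^sub>R v) ` {0..1}"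
  by (simp add: closed_segment_image_interval)

lemma closed_segment_0_scaleR:
  assumes "s \<ge> 0"
  shows "closed_segment 0 (s *\<^sub>R v) = (\<lambda>r. r *\<^sub>R v) ` {0..s}"
proof (cases "s = 0")
  case False
  have "(*) s ` {0..1} = {0..s}" using assms False by (simp add: image_mult_atLeastAtMost)
  then have "(\<lambda>r. r *\<^sub>R v) ` {0..s} = (\<lambda>r. r *\<^sub>R v) ` (*) s ` {0..1}" by simp
  then show ?thesis by (simp add: closed_segment_0_eq image_image mult.commute)
qed simp

text \<open>On each line parallel to \<open>b\<close> the convex set is an interval, and the segment
  only pushes its far end forward. So the layer gained between lengths \<open>s\<close> and
  \<open>s + t\<close> is the layer gained by \<open>P\<close> at length \<open>t\<close>, moved by
  \<open>s *\<^sub>R b\<close>.\<close>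

lemma convex_plus_segment_diff:
  fixes P :: "'a::real_normed_vector set" and b :: 'a
  assumes "convex P" "s \<ge> 0" "t \<ge> 0"
  defines "Q r \<equiv> P + closed_segment 0 (r *\<^sub>R b)"
  shows "Q (s + t) - Q s = (+) (s *\<^sub>R b) ` (Q t - P)"
proof -
  note st = assms(2,3)
  have Q: "Q r = {p + u *\<^sub>R b | p u. p \<in> P \<and> 0 \<le> u \<and> u \<le> r}" if "r \<ge> 0" for r
    using that by (auto simp: Q_def closed_segment_0_scaleR set_plus_def) fastforce+
  have QI: "p + u *\<^sub>R b \<in> Q r" if "p \<in> P" "0 \<le> u" "u \<le> r" for p u r
    using that by (subst Q) auto
  have "x - s *\<^sub>R b \<in> Q t - P" if x: "x \<in> Q (s + t) - Q s" for x
  proof -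
    obtain p u where p: "x = p + u *\<^sub>R b" "p \<in> P" "0 \<le> u" "u \<le> s + t"
      using x st by (auto simp: Q)
    have "u > s" using p x QI[of p u s] by force
    then have "x - s *\<^sub>R b = p + (u - s) *\<^sub>R b \<and> 0 \<le> u - s \<and> u - s \<le> t"
      using p by (simp add: algebra_simps)
    then have "x - s *\<^sub>R b \<in> Q t" using QI[of p "u - s" t] p(2) by simp
    moreover have "x - s *\<^sub>R b \<notin> P"
    proof
      assume "x - s *\<^sub>R b \<in> P"
      then have "x \<in> Q s" using QI[of "x - s *\<^sub>R b" s s] st by simp
      then show False using x by simp
    qed
    ultimately show ?thesis by simp
  qed
  moreover have "y + s *\<^sub>R b \<in> Q (s + t) - Q s" if y: "y \<in> Q t - P" for y
  proof -
    obtain p u where p: "y = p + u *\<^sub>R b" "p \<in> P" "0 \<le> u" "u \<le> t"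
      using y st by (auto simp: Q)
    have "y + s *\<^sub>R b = p + (u + s) *\<^sub>R b" using p by (simp add: algebra_simps)
    then have "y + s *\<^sub>R b \<in> Q (s + t)" using QI[of p "u + s" "s + t"] p(2-) st by simp
    moreover have "y + s *\<^sub>R b \<notin> Q s"
    proof
      assume "y + s *\<^sub>R b \<in> Q s"
      then obtain q v where q: "y + s *\<^sub>R b = q + v *\<^sub>R b" "q \<in> P" "0 \<le> v" "v \<le> s"
        using st by (auto simp: Q)
      define w where "w = s - v"
      have y1: "y = q - w *\<^sub>R b" using q(1) by (simp add: w_def algebra_simps)
      have w: "w \<ge> 0" using q by (simp add: w_def)
      show False
      proof (cases "u + w = 0")
        case True
        then have "u = 0" using p w by auto
        then show False using p y by simp
      next
        case False
        then have uw: "u + w > 0" using p w by auto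
        \<comment> \<open>Here \<open>y\<close> lies between \<open>p = y - u *\<^sub>R b\<close>
          and \<open>q = y + w *\<^sub>R b\<close>. The weights make the multiples of
          \<open>b\<close> cancel, so convexity puts \<open>y\<close> into \<open>P\<close>.\<close>
        define l m where "l = w / (u + w)" and "m = u / (u + w)"
        have lm: "l \<ge> 0" "m \<ge> 0" "l + m = 1" "l * u = m * w"
          using uw p w by (simp_all add: l_def m_def add_divide_distrib[symmetric] add.commute)
        have "l *\<^sub>R p + m *\<^sub>R q \<in> P"
          using p q lm by (intro convexD[OF assms(1)]) auto
        moreover have "y = l *\<^sub>R (p + u *\<^sub>R b) + m *\<^sub>R (q - w *\<^sub>R b)"
          unfolding p(1)[symmetric] y1[symmetric] scaleR_add_left[symmetric] lm by simp
        moreover have "\<dots> = l *\<^sub>R p + m *\<^sub>R q"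
          using lm(4) by (simp add: algebra_simps)
        ultimately show False using y by simp
      qed
    qed
    ultimately show ?thesis by simp
  qed
  ultimately have a: "\<And>x. x \<in> Q (s + t) - Q s \<Longrightarrow> x - s *\<^sub>R b \<in> Q t - P"
    and b: "\<And>y. y \<in> Q t - P \<Longrightarrow> y + s *\<^sub>R b \<in> Q (s + t) - Q s" by blast+
  show ?thesis
  proof (intro set_eqI iffI)
    fix x assume "x \<in> Q (s + t) - Q s"
    then show "x \<in> (+) (s *\<^sub>R b) ` (Q t - P)"
      by (intro image_eqI[OF _ a]) auto
  next
    fix x assume "x \<in> (+) (s *\<^sub>R b) ` (Q t - P)"
    then show "x \<in> Q (s + t) - Q s" using b by (auto simp: add.commute)
  qed
qed

text \<open>Cauchy's equation with monotonicity: trapping \<open>m * t\<close> between consecutive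
  integers bounds \<open>m * \<bar>g t - t * g 1\<bar>\<close> by \<open>g 1\<close> for every
  positive integer \<open>m\<close>.\<close>

lemma additive_nonneg_imp_linear:
  fixes g :: "real \<Rightarrow> real"
  assumes add: "\<And>s t. s \<ge> 0 \<Longrightarrow> t \<ge> 0 \<Longrightarrow> g (s + t) = g s + g t"
    and nonneg: "\<And>s. s \<ge> 0 \<Longrightarrow> g s \<ge> 0" and t: "t \<ge> 0"
  shows "g t = t * g 1"
proof -
  have g0: "g 0 = 0" using add[of 0 0] by simp
  have mono: "g s \<le> g r" if "0 \<le> s" "s \<le> r" for s r
    using add[of s "r - s"] nonneg[of "r - s"] that by simp
  have mult: "g (real k * x) = real k * g x" if "x \<ge> 0" for k x
    using that by (induction k) (simp_all add: g0 add algebra_simps)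
  have bound: "real (Suc n) * \<bar>g t - t * g 1\<bar> \<le> g 1" for n
  proof -
    define m where "m = real (Suc n)"
    have m: "m > 0" by (simp add: m_def)
    define k where "k = nat \<lfloor>m * t\<rfloor>"
    have "0 \<le> m * t" using m t by simp
    then have k: "real k \<le> m * t" "m * t \<le> real (Suc k)" unfolding k_def by linarith+
    have "real k * g 1 \<le> m * g t"
      using mono[of "real k * 1" "m * t"] k mult[of 1 k] mult[of t "Suc n"] t by (simp add: m_def)
    moreover have "m * g t \<le> real (Suc k) * g 1"
      using mono[of "m * t" "real (Suc k) * 1"] k mult[of 1 "Suc k"] mult[of t "Suc n"] t
      by (simp add: m_def)
    moreover have "real k * g 1 \<le> m * t * g 1" "m * t * g 1 \<le> real (Suc k) * g 1"
      using k nonneg[of 1] by (intro mult_right_mono; simp)+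
    moreover have "m * \<bar>g t - t * g 1\<bar> = \<bar>m * g t - m * t * g 1\<bar>"
      using m abs_mult[of m "g t - t * g 1"] by (simp add: algebra_simps)
    ultimately show ?thesis unfolding m_def by (simp add: algebra_simps abs_le_iff)
  qed
  show ?thesis
  proof (rule ccontr)
    assume "g t \<noteq> t * g 1"
    then obtain n where "g 1 < real n * \<bar>g t - t * g 1\<bar>"
      using reals_Archimedean3[of "\<bar>g t - t * g 1\<bar>"] by auto
    then show False using bound[of n] by (simp add: algebra_simps)
  qed
qed

text \<open>Translated layers have equal volume, so the gain in volume is additive in the length,
  and it is nonnegative; hence it is linear.\<close>

lemma measure_plus_segment:
  fixes P :: "'a::euclidean_space set"
  assumes P: "convex P" "compact P" and t: "t \<ge> 0"
  shows "measure lebesgue (P + closed_segment 0 (t *\<^sub>R b))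
    = measure lebesgue P + t * (measure lebesgue (P + closed_segment 0 b) - measure lebesgue P)"
proof -
  define Q where "Q r = P + closed_segment 0 (r *\<^sub>R b)" for r
  define f where "f r = measure lebesgue (Q r)" for r
  have lm: "Q r \<in> lmeasurable" "P \<in> lmeasurable" for r
    unfolding Q_def by (auto intro!: lmeasurable_compact compact_plus P)
  have sub: "Q s \<subseteq> Q (s + r)" if "0 \<le> s" "0 \<le> r" for s r
    unfolding Q_def using that by (intro set_plus_mono2) (auto simp: closed_segment_0_scaleR)
  have Q0: "Q 0 = P" by (simp add: Q_def)
  have diff: "f (s + r) - f s = measure lebesgue (Q r - P)" if "0 \<le> s" "0 \<le> r" for s r
  proof -
    have "f (s + r) - f s = measure lebesgue (Q (s + r) - Q s)"
      unfolding f_def using sub[OF that] lm by (simp add: measurable_measure_Diff fmeasurableD)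
    also have "\<dots> = measure lebesgue (Q r - P)"
      unfolding Q_def convex_plus_segment_diff[OF P(1) that] by (simp add: measure_translation)
    finally show ?thesis .
  qed
  have diff0: "measure lebesgue (Q r - P) = f r - f 0" if "0 \<le> r" for r
    using diff[of 0 r] that by simp
  have "f t - f 0 = t * (f 1 - f 0)"
  proof (rule additive_nonneg_imp_linear[OF _ _ t])
    show "f (s + r) - f 0 = f s - f 0 + (f r - f 0)" if "0 \<le> s" "0 \<le> r" for s r
      using diff[OF that] diff0[OF that(2)] by simp
    show "0 \<le> f s - f 0" if "0 \<le> s" for s
      unfolding diff0[OF that, symmetric] by simp
  qed
  then show ?thesis by (simp add: f_def Q0) (simp add: Q_def)
qed

text \<open>Splitting off a variable \<open>k\<close> leaves the value at \<open>s k = 0\<close> and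
  the slope in \<open>s k\<close>, both multiaffine in the rest. The slope supplies the coefficients
  of the sets containing \<open>k\<close>. Arguments outside \<open>I\<close> are pinned to 0, since
  nothing is known of \<open>h\<close> there.\<close>

lemma multiaffine_expansion:
  fixes h :: "('i \<Rightarrow> real) \<Rightarrow> real"
  assumes "finite I"
    and "\<And>s i r. i \<in> I \<Longrightarrow> (\<And>j. s j \<ge> 0) \<Longrightarrow> r \<ge> 0 \<Longrightarrow>
      h (s(i := r)) = h (s(i := 0)) + r * (h (s(i := 1)) - h (s(i := 0)))"
  shows "\<exists>c. \<forall>s. (\<forall>j. s j \<ge> 0) \<longrightarrow> (\<forall>j. j \<notin> I \<longrightarrow> s j = 0) \<longrightarrow> h s = (\<Sum>S\<in>Pow I. c S * (\<Prod>i\<in>S. s i))"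
  using assms
proof (induction I arbitrary: h rule: finite_induct)
  case empty
  show ?case
  proof (intro exI allI impI)
    fix s :: "'i \<Rightarrow> real" assume "\<forall>j. j \<notin> {} \<longrightarrow> s j = 0"
    then have "s = (\<lambda>_. 0)" by auto
    then show "h s = (\<Sum>S\<in>Pow {}. (\<lambda>_. h (\<lambda>_. 0)) S * prod s S)" by simp
  qed
next
  case (insert k I)
  define h' where "h' s = h (s(k := 1)) - h (s(k := 0))" for s
  have aff: "h (s(i := r)) = h (s(i := 0)) + r * (h (s(i := 1)) - h (s(i := 0)))"
    if "i \<in> I" "\<And>j. s j \<ge> 0" "r \<ge> 0" for s i r
    by (rule insert.prems) (use that in auto)
  have aff': "h' (s(i := r)) = h' (s(i := 0)) + r * (h' (s(i := 1)) - h' (s(i := 0)))"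
    if "i \<in> I" "\<And>j. s j \<ge> 0" "r \<ge> 0" for s i r
  proof -
    have ik: "i \<noteq> k" using insert.hyps that by auto
    have e: "h (s(k := x, i := r)) = h (s(k := x, i := 0)) + r * (h (s(k := x, i := 1)) - h (s(k := x, i := 0)))"
      if "x \<ge> 0" for x
      by (rule aff) (use \<open>i \<in> I\<close> \<open>\<And>j. s j \<ge> 0\<close> \<open>r \<ge> 0\<close> that in auto)
    show ?thesis
      unfolding h'_def fun_upd_twist[OF ik] e[OF zero_le_one] e[OF order_refl]
      by (simp add: algebra_simps)
  qed
  obtain c where c: "\<And>s. (\<forall>j. s j \<ge> 0) \<Longrightarrow> (\<forall>j. j \<notin> I \<longrightarrow> s j = 0) \<Longrightarrow> h s = (\<Sum>S\<in>Pow I. c S * (\<Prod>i\<in>S. s i))"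
    using insert.IH[OF aff] by blast
  obtain c' where c': "\<And>s. (\<forall>j. s j \<ge> 0) \<Longrightarrow> (\<forall>j. j \<notin> I \<longrightarrow> s j = 0) \<Longrightarrow> h' s = (\<Sum>S\<in>Pow I. c' S * (\<Prod>i\<in>S. s i))"
    using insert.IH[OF aff'] by blast
  define d where "d S = (if k \<in> S then c' (S - {k}) else c S)" for S
  have "h s = (\<Sum>S\<in>Pow (insert k I). d S * (\<Prod>i\<in>S. s i))"
    if s: "\<forall>j. s j \<ge> 0" "\<forall>j. j \<notin> insert k I \<longrightarrow> s j = 0" for s
  proof -
    define s0 where "s0 = s(k := 0)"
    have s0: "\<forall>j. s0 j \<ge> 0" "\<forall>j. j \<notin> I \<longrightarrow> s0 j = 0" using s by (auto simp: s0_def)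
    have pr: "(\<Prod>i\<in>S. s0 i) = (\<Prod>i\<in>S. s i)" if "S \<in> Pow I" for S
      using that insert.hyps by (intro prod.cong) (auto simp: s0_def)
    have "h s = h s0 + s k * h' s0"
    proof -
      have "h (s(k := s k)) = h (s(k := 0)) + s k * (h (s(k := 1)) - h (s(k := 0)))"
        by (rule insert.prems) (use s in auto)
      then show ?thesis by (simp add: s0_def h'_def)
    qed
    also have "\<dots> = (\<Sum>S\<in>Pow I. c S * (\<Prod>i\<in>S. s i)) + (\<Sum>S\<in>Pow I. s k * (c' S * (\<Prod>i\<in>S. s i)))"
      using c[OF s0] c'[OF s0] pr by (simp add: sum_distrib_left)
    also have "(\<Sum>S\<in>Pow I. c S * (\<Prod>i\<in>S. s i)) = (\<Sum>S\<in>Pow I. d S * (\<Prod>i\<in>S. s i))"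
      using insert.hyps by (intro sum.cong) (auto simp: d_def)
    also have "(\<Sum>S\<in>Pow I. s k * (c' S * (\<Prod>i\<in>S. s i))) = (\<Sum>S\<in>Pow I. d (insert k S) * (\<Prod>i\<in>insert k S. s i))"
    proof (intro sum.cong refl)
      fix S assume S: "S \<in> Pow I"
      then have "k \<notin> S" "finite S" using insert.hyps finite_subset by auto
      then show "s k * (c' S * (\<Prod>i\<in>S. s i)) = d (insert k S) * (\<Prod>i\<in>insert k S. s i)"
        by (simp add: d_def)
    qed
    also have "\<dots> = (\<Sum>S\<in>insert k ` Pow I. d S * (\<Prod>i\<in>S. s i))"
      using insert.hyps by (subst sum.reindex) (auto intro!: inj_onI simp: o_def)
    also have "(\<Sum>S\<in>Pow I. d S * (\<Prod>i\<in>S. s i)) + \<dots> = (\<Sum>S\<in>Pow (insert k I). d S * (\<Prod>i\<in>S. s i))"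
      unfolding Pow_insert using insert.hyps by (intro sum.union_disjoint[symmetric]) auto
    finally show ?thesis .
  qed
  then show ?case by blast
qed

lemma poly_eq_0_if_zero_on_nonneg:
  fixes p :: "real poly"
  assumes "\<And>t. t \<ge> 0 \<Longrightarrow> poly p t = 0"
  shows "p = 0"
proof (rule ccontr)
  assume "p \<noteq> 0"
  then have "finite {t. poly p t = 0}" by (rule poly_roots_finite)
  then have "finite {0::real..}" by (rule finite_subset[rotated]) (use assms in auto)
  then show False by (simp add: infinite_Ici)
qed

text \<open>Homogeneity keeps only the monomials with three variables, and the value at the
  indicator of a triple isolates its coefficient.\<close>

lemma multiaffine_cubic_eq_sum_triples:
  fixes h :: "('i \<Rightarrow> real) \<Rightarrow> real"
  assumes fin: "finite I"
    and aff: "\<And>s i r. i \<in> I \<Longrightarrow> (\<And>j. s j \<ge> 0) \<Longrightarrow> r \<ge> 0 \<Longrightarrow>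
      h (s(i := r)) = h (s(i := 0)) + r * (h (s(i := 1)) - h (s(i := 0)))"
    and hom: "\<And>s t. (\<And>j. s j \<ge> 0) \<Longrightarrow> t \<ge> 0 \<Longrightarrow> h (\<lambda>i. t * s i) = t ^ 3 * h s"
  shows "h (indicator I) = (\<Sum>S | S \<subseteq> I \<and> card S = 3. h (indicator S))"
proof -
  obtain c where c: "\<And>s. (\<forall>j. s j \<ge> 0) \<Longrightarrow> (\<forall>j. j \<notin> I \<longrightarrow> s j = 0) \<Longrightarrow> h s = (\<Sum>S\<in>Pow I. c S * (\<Prod>i\<in>S. s i))"
    using multiaffine_expansion[OF fin aff] by blast
  have cubic: "h s = (\<Sum>S | S \<subseteq> I \<and> card S = 3. c S * (\<Prod>i\<in>S. s i))"
    if s: "\<forall>j. s j \<ge> 0" "\<forall>j. j \<notin> I \<longrightarrow> s j = 0" for s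
  proof -
    \<comment> \<open>The polynomial in \<open>t\<close> expressing
      \<open>h (\<lambda>i. t * s i) - t ^ 3 * h s\<close>; its coefficient at degree 3 gives the
      claim.\<close>
    define p where "p = (\<Sum>S\<in>Pow I. monom (c S * (\<Prod>i\<in>S. s i)) (card S)) - monom (h s) 3"
    have "poly p t = 0" if t: "t \<ge> 0" for t
    proof -
      have "t ^ 3 * h s = h (\<lambda>i. t * s i)" using hom[of s t] s t by simp
      also have "\<dots> = (\<Sum>S\<in>Pow I. c S * (\<Prod>i\<in>S. t * s i))" using s t by (intro c) auto
      also have "\<dots> = (\<Sum>S\<in>Pow I. c S * (\<Prod>i\<in>S. s i) * t ^ card S)"
        by (intro sum.cong refl) (simp add: prod.distrib mult_ac)
      finally show ?thesis by (simp add: p_def poly_sum poly_monom mult.commute)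
    qed
    then have "p = 0" by (rule poly_eq_0_if_zero_on_nonneg)
    then have "coeff p 3 = 0" by simp
    then have "h s = (\<Sum>S\<in>Pow I. if card S = 3 then c S * (\<Prod>i\<in>S. s i) else 0)"
      by (simp add: p_def coeff_sum)
    also have "\<dots> = (\<Sum>S | S \<subseteq> I \<and> card S = 3. c S * (\<Prod>i\<in>S. s i))"
      using fin by (simp add: sum.If_cases Int_def Pow_def)
    finally show ?thesis .
  qed
  have "h (indicator S) = c S" if S: "S \<subseteq> I" "card S = 3" for S
  proof -
    have finS: "finite S" using S fin finite_subset by auto
    have "h (indicator S) = (\<Sum>T | T \<subseteq> I \<and> card T = 3. c T * (\<Prod>i\<in>T. indicator S i))"
      using S by (intro cubic) (auto simp: indicator_def)
    also have "\<dots> = (\<Sum>T | T \<subseteq> I \<and> card T = 3. if T = S then c S else 0)"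
    proof (intro sum.cong refl)
      fix T assume T: "T \<in> {T. T \<subseteq> I \<and> card T = 3}"
      then have finT: "finite T" using fin finite_subset by auto
      show "c T * (\<Prod>i\<in>T. indicator S i) = (if T = S then c S else 0)"
      proof (cases "T \<subseteq> S")
        case True
        then have "T = S" using T S finS by (metis (lifting) card_subset_eq mem_Collect_eq)
        then show ?thesis by simp
      next
        case False
        then have "T \<noteq> S" "(\<Prod>i\<in>T. indicator S i) = (0::real)" using finT by (auto simp: indicator_def)
        then show ?thesis by simp
      qed
    qed
    also have "\<dots> = c S" using S fin by (simp add: sum.delta')
    finally show ?thesis .
  qed
  moreover have "h (indicator I) = (\<Sum>S | S \<subseteq> I \<and> card S = 3. c S * (\<Prod>i\<in>S. indicator I i))"
    by (intro cubic) (auto simp: indicator_def)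
  moreover have "\<dots> = (\<Sum>S | S \<subseteq> I \<and> card S = 3. c S)"
    by (intro sum.cong refl) (auto simp: indicator_def subset_iff intro!: prod.neutral)
  ultimately show ?thesis by simp
qed

section \<open>Scaling, parallelepipeds and the volume of a sum of segments\<close>

lemma image_scaleR_plus: "(*\<^sub>R) t ` (S + T) = (*\<^sub>R) t ` S + (*\<^sub>R) t ` T"
  for S T :: "'a::real_vector set"
proof -
  have "(*\<^sub>R) t ` (\<lambda>(x, y). x + y) ` (S \<times> T) = (\<lambda>(x, y). x + y) ` map_prod ((*\<^sub>R) t) ((*\<^sub>R) t) ` (S \<times> T)"
    by (simp add: image_image case_prod_beta scaleR_right_distrib)
  then show ?thesis unfolding set_plus_image map_prod_surj_on[OF refl refl] .
qed

lemma measure_scaleR_image: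
  fixes S :: "'a::euclidean_space set"
  shows "measure lebesgue ((*\<^sub>R) t ` S) = \<bar>t\<bar> ^ DIM('a) * measure lebesgue S"
  using measure_lebesgue_affine[of t 0 S] by simp

lemma measure_singleton_plus:
  fixes S :: "'a::euclidean_space set"
  shows "measure lebesgue ({p} + S) = measure lebesgue S"
  by (simp add: singleton_plus measure_translation)

lemma compact_sum_sets:
  fixes f :: "'i \<Rightarrow> 'a::real_normed_vector set"
  assumes "\<And>i. i \<in> I \<Longrightarrow> compact (f i)"
  shows "compact (sum f I)"
  using assms by (induction I rule: infinite_finite_induct) (auto intro: compact_plus)

lemma vol_parallelepiped:
  "vol (closed_segment 0 a + closed_segment 0 b + closed_segment 0 c) = \<bar>det3 a b c\<bar>"
proof -
  define f where "f u = u$1 *\<^sub>R a + u$2 *\<^sub>R b + u$3 *\<^sub>R c" for u :: "real^3"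
  have lin: "linear f"
    by (rule linearI) (simp_all add: f_def algebra_simps)
  have "closed_segment 0 a + closed_segment 0 b + closed_segment 0 c = f ` cbox 0 1" (is "?L = ?R")
  proof (intro set_eqI iffI)
    fix x assume "x \<in> ?L"
    then obtain r s t where r: "x = r *\<^sub>R a + s *\<^sub>R b + t *\<^sub>R c" "r \<in> {0..1}" "s \<in> {0..1}" "t \<in> {0..1}"
      by (auto simp: closed_segment_0_eq set_plus_def)
    have "x = f (vector [r, s, t])" by (simp add: f_def r)
    moreover have "(vector [r, s, t] :: real^3) \<in> cbox 0 1"
      using r by (auto simp: mem_box_cart forall_3)
    ultimately show "x \<in> ?R" by blast
  next
    fix x assume "x \<in> ?R"
    then obtain u where u: "x = f u" "u \<in> cbox 0 1" by blast
    then have "\<And>i. u $ i \<in> {0..1}" by (auto simp: mem_box_cart)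
    then show "x \<in> ?L" unfolding u f_def closed_segment_0_eq
      by (intro set_plus_intro imageI)
  qed
  moreover have "det (matrix f) = det3 a b c"
    unfolding det_3 matrix_def f_def det3_def by (simp add: axis_def algebra_simps)
  moreover have "measure lebesgue (cbox 0 (1 :: real^3)) = 1"
  proof -
    have "cbox 0 (1 :: real^3) \<noteq> {}" by (simp add: interval_ne_empty_cart)
    then show ?thesis by (simp add: content_cbox_cart)
  qed
  ultimately show ?thesis
    using measure_linear_image[OF lin, of "cbox 0 1"] by simp
qed

text \<open>Ordered triples are grouped by their underlying set: a set of three elements has six
  orderings, and triples with a repeated index contribute 0.\<close>

lemma sum_triples_eq_sum_subsets:
  fixes d :: "'i \<Rightarrow> 'i \<Rightarrow> 'i \<Rightarrow> real" and g :: "'i set \<Rightarrow> real"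
  assumes fin: "finite I"
    and sym: "\<And>i j k. d i j k = d j i k" "\<And>i j k. d i j k = d i k j"
    and zero: "\<And>i k. d i i k = 0"
    and g: "\<And>i j k. i \<in> I \<Longrightarrow> j \<in> I \<Longrightarrow> k \<in> I \<Longrightarrow> card {i, j, k} = 3 \<Longrightarrow> g {i, j, k} = d i j k"
  shows "(\<Sum>i\<in>I. \<Sum>j\<in>I. \<Sum>k\<in>I. d i j k) = 6 * (\<Sum>S | S \<subseteq> I \<and> card S = 3. g S)"
proof -
  define D where "D = (\<lambda>(i, j, k). d i j k)"
  define st where "st = (\<lambda>(i::'i, j, k). {i, j, k})"
  define X where "X = {p \<in> I \<times> I \<times> I. card (st p) = 3}"
  have finX: "finite X" unfolding X_def using fin by (intro finite_Collect_conjI disjI1) auto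
  have inner: "(\<Sum>p | p \<in> X \<and> st p = S. D p) = 6 * g S" if S: "S \<subseteq> I" "card S = 3" for S
  proof -
    obtain a b c where abc: "S = {a, b, c}" "a \<noteq> b" "b \<noteq> c" "a \<noteq> c"
      using S(2) by (auto simp: card_3_iff)
    have "{p. p \<in> X \<and> st p = S} = {(a,b,c), (a,c,b), (b,a,c), (b,c,a), (c,a,b), (c,b,a)}" (is "?L = ?R")
    proof (intro set_eqI iffI)
      fix p assume "p \<in> ?L"
      then obtain i j k where p: "p = (i, j, k)" "{i, j, k} = {a, b, c}"
        by (cases p) (auto simp: st_def abc)
      have "i = a \<or> i = b \<or> i = c" "j = a \<or> j = b \<or> j = c" "k = a \<or> k = b \<or> k = c"
        "a = i \<or> a = j \<or> a = k" "b = i \<or> b = j \<or> b = k" "c = i \<or> c = j \<or> c = k"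
        using p(2) by blast+
      then show "p \<in> ?R" unfolding p(1) using abc(2-) by auto
    next
      fix p assume "p \<in> ?R"
      then have "st p = S" "p \<in> I \<times> I \<times> I" using S(1) by (auto simp: st_def abc)
      then show "p \<in> ?L" using S(2) by (simp add: X_def)
    qed
    then have "(\<Sum>p | p \<in> X \<and> st p = S. D p) = d a b c + d a c b + d b a c + d b c a + d c a b + d c b a"
      using abc by (simp add: D_def)
    also have "\<dots> = 6 * d a b c"
      using sym(1)[of a b c] sym(2)[of a b c] sym(2)[of b a c] sym(1)[of a c b] sym(1)[of b c a] by linarith
    also have "d a b c = g S" using g[of a b c] S abc by auto
    finally show ?thesis .
  qed
  have "(\<Sum>i\<in>I. \<Sum>j\<in>I. \<Sum>k\<in>I. d i j k) = sum D (I \<times> I \<times> I)"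
    by (simp add: D_def sum.cartesian_product)
  also have "\<dots> = sum D X"
  proof (rule sum.mono_neutral_right)
    show "\<forall>p\<in>I \<times> I \<times> I - X. D p = 0"
    proof
      fix p assume p: "p \<in> I \<times> I \<times> I - X"
      obtain i j k where ijk: "p = (i, j, k)" by (cases p)
      have "i = j \<or> j = k \<or> i = k" using p by (auto simp: X_def st_def ijk card_insert_if split: if_splits)
      then have "d i j k = 0" using zero[of i k] zero[of j i] zero[of i j] sym(1)[of i j j] sym(2)[of j i j] sym(2)[of i j i] by auto
      then show "D p = 0" by (simp add: D_def ijk)
    qed
  qed (use fin in \<open>auto simp: X_def\<close>)
  also have "\<dots> = (\<Sum>S | S \<subseteq> I \<and> card S = 3. \<Sum>p | p \<in> X \<and> st p = S. D p)"
    using finX fin by (intro sum.group[symmetric]) (auto simp: X_def st_def)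
  also have "\<dots> = (\<Sum>S | S \<subseteq> I \<and> card S = 3. 6 * g S)" by (intro sum.cong refl) (use inner in auto)
  finally show ?thesis by (simp add: sum_distrib_left)
qed

text \<open>As a function of the segment lengths the volume is multiaffine and cubic, so it is the
  sum of its values on triples of generators, which are volumes of parallelepipeds.\<close>

lemma vol_sum_segments:
  fixes v :: "'i \<Rightarrow> real^3"
  assumes fin: "finite I"
  shows "6 * vol (\<Sum>i\<in>I. closed_segment 0 (v i)) = (\<Sum>i\<in>I. \<Sum>j\<in>I. \<Sum>k\<in>I. \<bar>det3 (v i) (v j) (v k)\<bar>)"
proof -
  define Z where "Z s = (\<Sum>i\<in>I. closed_segment 0 (s i *\<^sub>R v i))" for s :: "'i \<Rightarrow> real"
  define h where "h s = vol (Z s)" for s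
  have aff: "h (s(i := r)) = h (s(i := 0)) + r * (h (s(i := 1)) - h (s(i := 0)))"
    if "i \<in> I" "r \<ge> 0" for s i r
  proof -
    define P where "P = (\<Sum>j\<in>I - {i}. closed_segment 0 (s j *\<^sub>R v j))"
    have "Z (s(i := r)) = P + closed_segment 0 (r *\<^sub>R v i)" for r
    proof -
      have "Z (s(i := r)) = closed_segment 0 (r *\<^sub>R v i) + (\<Sum>j\<in>I - {i}. closed_segment 0 ((s(i := r)) j *\<^sub>R v j))"
        unfolding Z_def by (subst sum.remove[OF fin that(1)]) simp
      also have "(\<Sum>j\<in>I - {i}. closed_segment 0 ((s(i := r)) j *\<^sub>R v j)) = P"
        unfolding P_def by (intro sum.cong) auto
      finally show ?thesis unfolding add.commute[of P] .
    qed
    moreover have "convex P" "compact P"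
      unfolding P_def by (auto intro!: convex_set_sum compact_sum_sets)
    ultimately show ?thesis
      using measure_plus_segment[of P r "v i"] that by (simp add: h_def)
  qed
  have hom: "h (\<lambda>i. t * s i) = t ^ 3 * h s" if "t \<ge> 0" for t s
  proof -
    have "(*\<^sub>R) t ` closed_segment 0 (s i *\<^sub>R v i) = closed_segment 0 ((t * s i) *\<^sub>R v i)" for i
      by (simp add: closed_segment_0_eq image_image mult_ac)
    moreover have "(*\<^sub>R) t ` Z s = (\<Sum>i\<in>I. (*\<^sub>R) t ` closed_segment 0 (s i *\<^sub>R v i))"
      unfolding Z_def by (subst sum_set_linear) (auto simp: image_scaleR_plus o_def)
    ultimately have "(*\<^sub>R) t ` Z s = Z (\<lambda>i. t * s i)" by (simp add: Z_def)
    then show ?thesis using that measure_scaleR_image[of t "Z s"] by (simp add: h_def)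
  qed
  have Zind: "Z (indicator S) = (\<Sum>i\<in>S. closed_segment 0 (v i))" if "S \<subseteq> I" for S
  proof -
    have "Z (indicator S) = (\<Sum>i\<in>S. closed_segment 0 (indicator S i *\<^sub>R v i))"
      unfolding Z_def using that fin by (intro sum.mono_neutral_right) (auto simp: indicator_def)
    then show ?thesis by simp
  qed
  have "h (indicator I) = (\<Sum>S | S \<subseteq> I \<and> card S = 3. h (indicator S))"
    using fin aff hom by (rule multiaffine_cubic_eq_sum_triples)
  moreover have "(\<Sum>i\<in>I. \<Sum>j\<in>I. \<Sum>k\<in>I. \<bar>det3 (v i) (v j) (v k)\<bar>) = 6 * (\<Sum>S | S \<subseteq> I \<and> card S = 3. h (indicator S))"
  proof (rule sum_triples_eq_sum_subsets[OF fin abs_det3_swap])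
    show "\<bar>det3 (v i) (v i) (v k)\<bar> = 0" for i k by (simp add: det3_def algebra_simps)
    show "h (indicator {i, j, k}) = \<bar>det3 (v i) (v j) (v k)\<bar>"
      if "i \<in> I" "j \<in> I" "k \<in> I" "card {i, j, k} = 3" for i j k
    proof -
      have "i \<noteq> j" "j \<noteq> k" "i \<noteq> k" using that(4) by (auto simp: card_insert_if split: if_splits)
      then show ?thesis using that Zind[of "{i, j, k}"] vol_parallelepiped[of "v i" "v j" "v k"]
        by (simp add: h_def add.assoc)
    qed
  qed
  ultimately show ?thesis using Zind[of I] by (simp add: h_def)
qed

text \<open>Position is forgotten and generators are listed with multiplicity, so that Minkowski
  addition becomes \<open>@\<close> and the volume is a function of the list.\<close>

definition zonotope_of :: "'a::euclidean_space set \<Rightarrow> 'a list \<Rightarrow> bool" where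
  "zonotope_of Z vs \<longleftrightarrow> (\<exists>p. Z = {p} + (\<Sum>v\<leftarrow>vs. closed_segment 0 v))"

lemma zonotope_of_plus:
  assumes "zonotope_of Z vs" "zonotope_of W ws"
  shows "zonotope_of (Z + W) (vs @ ws)"
proof -
  obtain p q where "Z = {p} + (\<Sum>v\<leftarrow>vs. closed_segment 0 v)" "W = {q} + (\<Sum>v\<leftarrow>ws. closed_segment 0 v)"
    using assms by (auto simp: zonotope_of_def)
  then have "Z + W = ({p} + {q}) + (\<Sum>v\<leftarrow>vs @ ws. closed_segment 0 v)" by (simp add: add_ac)
  moreover have "{p} + {q} = {p + q}" by (simp add: singleton_plus)
  ultimately show ?thesis unfolding zonotope_of_def by metis
qed

lemma zonotope_of_scaleR:
  assumes "zonotope_of Z vs"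
  shows "zonotope_of ((*\<^sub>R) t ` Z) (map ((*\<^sub>R) t) vs)"
proof -
  have "(*\<^sub>R) t ` closed_segment 0 v = closed_segment 0 (t *\<^sub>R v)" for v :: 'a
    by (simp add: closed_segment_0_eq image_image mult_ac)
  then have "(*\<^sub>R) t ` (\<Sum>v\<leftarrow>vs. closed_segment 0 v) = (\<Sum>v\<leftarrow>map ((*\<^sub>R) t) vs. closed_segment 0 v)"
    by (induction vs) (simp_all add: image_scaleR_plus)
  then show ?thesis using assms unfolding zonotope_of_def by (auto simp: image_scaleR_plus)
qed

lemma zonotope_of_convex_compact:
  assumes "zonotope_of Z vs"
  shows "convex Z" "compact Z" "Z \<noteq> {}"
proof -
  have "convex (\<Sum>v\<leftarrow>vs. closed_segment 0 v) \<and> compact (\<Sum>v\<leftarrow>vs. closed_segment 0 v) \<and> (\<Sum>v\<leftarrow>vs. closed_segment 0 v) \<noteq> {}"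
  proof (induction vs)
    case (Cons a vs)
    moreover have "S + T \<noteq> {}" if "S \<noteq> {}" "T \<noteq> {}" for S T :: "'a set"
      using that by (auto simp: set_plus_def)
    ultimately show ?case by (simp add: convex_set_plus compact_plus)
  qed auto
  then show "convex Z" "compact Z" "Z \<noteq> {}"
    using assms by (auto simp: zonotope_of_def singleton_plus intro: convex_translation compact_translation)
qed

lemma zonotope_of_vol:
  assumes "zonotope_of Z vs"
  shows "vol Z = zvol vs"
proof -
  have I: "(\<Sum>x\<leftarrow>vs. f x) = (\<Sum>i<length vs. f (vs ! i))" for f :: "real^3 \<Rightarrow> 'b::comm_monoid_add"
    by (simp add: sum_list_sum_nth atLeast0LessThan)
  show ?thesis
    using assms vol_sum_segments[of "{..<length vs}" "\<lambda>i. vs ! i"]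
    by (auto simp: zonotope_of_def measure_singleton_plus I zvol_def detsum_def)
qed

lemma zonotope_imp_zonotope_of:
  assumes "zonotope Z"
  obtains vs where "zonotope_of Z vs"
proof -
  obtain n :: nat and a b where Z: "Z = (\<Sum>i<n. closed_segment (a i) (b i))"
    using assms by (auto simp: zonotope_def)
  have "closed_segment (a i) (b i) = {a i} + closed_segment 0 (b i - a i)" for i
    using closed_segment_translation[of "a i" 0 "b i - a i"] by (simp add: singleton_plus)
  then have "zonotope_of (closed_segment (a i) (b i)) [b i - a i]" for i
    unfolding zonotope_of_def by (intro exI[of _ "a i"]) simp
  then have "\<exists>vs. zonotope_of (\<Sum>i<n. closed_segment (a i) (b i)) vs"
  proof (induction n)
    case 0
    have "zonotope_of ({0} :: 'a set) []" by (simp add: zonotope_of_def)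
    then show ?case by auto
  next
    case (Suc n)
    then obtain vs where "zonotope_of (\<Sum>i<n. closed_segment (a i) (b i)) vs" by blast
    from zonotope_of_plus[OF this Suc.prems[of n]] show ?case by (auto simp: add.commute)
  qed
  then show ?thesis using that Z by auto
qed

section \<open>Continuity of volume under Hausdorff limits\<close>

text \<open>Hausdorff convergence, phrased by ball enlargements so that it combines directly with
  Minkowski sums.\<close>

definition hconv :: "(nat \<Rightarrow> 'a::euclidean_space set) \<Rightarrow> 'a set \<Rightarrow> bool" where
  "hconv K L \<longleftrightarrow> (\<forall>e>0. \<forall>\<^sub>F n in sequentially. K n \<subseteq> L + cball 0 e \<and> L \<subseteq> K n + cball 0 e)"

lemma plus_cball_eq: "S + cball 0 e = {x. \<exists>y\<in>S. dist y x \<le> e}"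
  for S :: "'a::euclidean_space set"
proof (intro set_eqI iffI)
  fix x assume "x \<in> S + cball 0 e"
  then obtain y w where "x = y + w" "y \<in> S" "norm w \<le> e" by (auto simp: set_plus_def)
  then show "x \<in> {x. \<exists>y\<in>S. dist y x \<le> e}" by (auto simp: dist_norm intro!: bexI[of _ y])
next
  fix x assume "x \<in> {x. \<exists>y\<in>S. dist y x \<le> e}"
  then obtain y where y: "y \<in> S" "dist y x \<le> e" by blast
  then have "y + (x - y) \<in> S + cball 0 e"
    by (intro set_plus_intro) (auto simp: dist_norm norm_minus_commute)
  then show "x \<in> S + cball 0 e" by simp
qed

lemma cball_plus_cball_subset: "cball 0 d + cball 0 e \<subseteq> cball (0::'a::euclidean_space) (d + e)"
  by (auto simp: set_plus_def intro: norm_triangle_mono)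

lemma hconv_plus:
  assumes "hconv K L" "hconv K' L'"
  shows "hconv (\<lambda>n. K n + K' n) (L + L')"
  unfolding hconv_def
proof (intro allI impI)
  fix e :: real assume e: "e > 0"
  have sub: "(A + cball 0 (e/2)) + (B + cball 0 (e/2)) \<subseteq> A + B + cball 0 e" for A B :: "'a set"
  proof -
    have "(A + cball 0 (e/2)) + (B + cball 0 (e/2)) = (A + B) + (cball 0 (e/2) + cball 0 (e/2))"
      by (simp add: add_ac)
    also have "\<dots> \<subseteq> A + B + cball 0 e"
      using cball_plus_cball_subset[of "e/2" "e/2"] by (intro set_plus_mono2) auto
    finally show ?thesis .
  qed
  have "\<forall>\<^sub>F n in sequentially. K n \<subseteq> L + cball 0 (e/2) \<and> L \<subseteq> K n + cball 0 (e/2)"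
    "\<forall>\<^sub>F n in sequentially. K' n \<subseteq> L' + cball 0 (e/2) \<and> L' \<subseteq> K' n + cball 0 (e/2)"
    using assms e by (simp_all add: hconv_def)
  then show "\<forall>\<^sub>F n in sequentially. K n + K' n \<subseteq> L + L' + cball 0 e \<and> L + L' \<subseteq> K n + K' n + cball 0 e"
  proof eventually_elim
    case (elim n)
    then have "K n + K' n \<subseteq> (L + cball 0 (e/2)) + (L' + cball 0 (e/2))"
      "L + L' \<subseteq> (K n + cball 0 (e/2)) + (K' n + cball 0 (e/2))" by (intro set_plus_mono2; simp)+
    then show ?case using sub by blast
  qed
qed

lemma hconv_scaleR:
  assumes "hconv K L"
  shows "hconv (\<lambda>n. (*\<^sub>R) t ` K n) ((*\<^sub>R) t ` L)"
  unfolding hconv_def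
proof (intro allI impI)
  fix e :: real assume e: "e > 0"
  \<comment> \<open>The summand 1 keeps the denominator positive when \<open>t = 0\<close>.\<close>
  define d where "d = e / (\<bar>t\<bar> + 1)"
  have d: "d > 0" "\<bar>t\<bar> * d \<le> e" using e by (auto simp: d_def field_simps)
  have sub: "(*\<^sub>R) t ` A \<subseteq> (*\<^sub>R) t ` B + cball 0 e" if "A \<subseteq> B + cball 0 d" for A B :: "'a set"
  proof -
    have "(*\<^sub>R) t ` cball (0::'a) d \<subseteq> cball 0 e"
    proof (intro image_subsetI)
      fix x :: 'a assume "x \<in> cball 0 d"
      then have "\<bar>t\<bar> * norm x \<le> \<bar>t\<bar> * d" by (intro mult_left_mono) auto
      then show "t *\<^sub>R x \<in> cball 0 e" using d by simp
    qed
    then have "(*\<^sub>R) t ` (B + cball 0 d) \<subseteq> (*\<^sub>R) t ` B + cball 0 e"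
      unfolding image_scaleR_plus by (intro set_plus_mono2) auto
    then show ?thesis using that by blast
  qed
  have "\<forall>\<^sub>F n in sequentially. K n \<subseteq> L + cball 0 d \<and> L \<subseteq> K n + cball 0 d"
    using assms d by (simp add: hconv_def)
  then show "\<forall>\<^sub>F n in sequentially. (*\<^sub>R) t ` K n \<subseteq> (*\<^sub>R) t ` L + cball 0 e \<and> (*\<^sub>R) t ` L \<subseteq> (*\<^sub>R) t ` K n + cball 0 e"
    by eventually_elim (simp add: sub)
qed

lemma in_closed_if_in_all_enlargements:
  fixes K :: "'a::euclidean_space set"
  assumes "closed K" "\<And>e. e > 0 \<Longrightarrow> x \<in> K + cball 0 e"
  shows "x \<in> K"
proof -
  have "x \<in> closure K"
    unfolding closure_approachable_le using assms(2) by (simp add: plus_cball_eq)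
  then show ?thesis using assms(1) by simp
qed

text \<open>Points of \<open>L\<close> lie in a convex enlargement of some \<open>K n\<close>, which
  lies in an enlargement of \<open>L\<close>; closedness lets the radius go to 0.\<close>

lemma convex_hconv_limit:
  fixes K :: "nat \<Rightarrow> 'a::euclidean_space set"
  assumes "hconv K L" "closed L" "\<And>n. convex (K n)"
  shows "convex L"
proof (rule convexI)
  fix x y u v assume xy: "x \<in> L" "y \<in> L" and uv: "0 \<le> u" "0 \<le> v" "u + v = (1::real)"
  show "u *\<^sub>R x + v *\<^sub>R y \<in> L"
  proof (rule in_closed_if_in_all_enlargements[OF assms(2)])
    fix e :: real assume e: "e > 0"
    have "\<forall>\<^sub>F n in sequentially. K n \<subseteq> L + cball 0 (e/2) \<and> L \<subseteq> K n + cball 0 (e/2)"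
      using assms e by (simp add: hconv_def)
    then obtain n where n: "K n \<subseteq> L + cball 0 (e/2)" "L \<subseteq> K n + cball 0 (e/2)"
      using eventually_happens trivial_limit_sequentially by blast
    have "convex (K n + cball 0 (e/2))" using assms by (intro convex_set_plus) auto
    then have "u *\<^sub>R x + v *\<^sub>R y \<in> K n + cball 0 (e/2)"
      using convexD xy uv n(2) by (metis subsetD)
    also have "\<dots> \<subseteq> (L + cball 0 (e/2)) + cball 0 (e/2)"
      using n(1) by (intro set_plus_mono2) auto
    also have "\<dots> = L + (cball 0 (e/2) + cball 0 (e/2))" by (simp add: add.assoc)
    also have "\<dots> \<subseteq> L + cball 0 e"
      using cball_plus_cball_subset[of "e/2" "e/2"] by (intro set_plus_mono2) auto
    finally show "u *\<^sub>R x + v *\<^sub>R y \<in> L + cball 0 e" .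
  qed
qed

text \<open>A point \<open>x\<close> outside \<open>Y\<close> is separated from it by a hyperplane.
  Moving \<open>x\<close> by \<open>e\<close> away from \<open>Y\<close> leaves the enlargement of
  \<open>Y\<close>.\<close>

lemma plus_cball_cancel:
  fixes X Y :: "'a::euclidean_space set"
  assumes sub: "X + cball 0 e \<subseteq> Y + cball 0 e" and Y: "convex Y" "closed Y" and e: "e \<ge> 0"
  shows "X \<subseteq> Y"
proof
  fix x assume x: "x \<in> X"
  show "x \<in> Y"
  proof (rule ccontr)
    assume "x \<notin> Y"
    then obtain a b where ab: "inner a x < b" "\<And>y. y \<in> Y \<Longrightarrow> inner a y > b"
      using separating_hyperplane_closed_point[OF Y] by blast
    have "x + (- e) *\<^sub>R sgn a \<in> X + cball 0 e"
      using x e by (intro set_plus_intro) (auto simp: norm_sgn)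
    then obtain y w where yw: "x + (- e) *\<^sub>R sgn a = y + w" "y \<in> Y" "norm w \<le> e"
      using set_plus_elim[OF subsetD[OF sub]] by (metis mem_cball_0)
    have "inner a x - e * norm a = inner a (x + (- e) *\<^sub>R sgn a)"
      by (cases "a = 0") (simp_all add: inner_diff_right sgn_div_norm power2_norm_eq_inner[symmetric] power2_eq_square)
    also have "\<dots> = inner a y + inner a w" unfolding yw(1) inner_add_right ..
    also have "inner a w \<ge> - (norm a * norm w)"
      using Cauchy_Schwarz_ineq2[of a w] by linarith
    moreover have "norm a * norm w \<le> norm a * e" using yw(3) by (intro mult_left_mono) auto
    ultimately have "inner a x \<ge> inner a y" by (simp add: mult.commute)
    then show False using ab(1) ab(2)[OF yw(2)] by simp
  qed
qed

text \<open>The enlargements decrease to \<open>L\<close> because \<open>L\<close> is closed, and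
  measure is continuous from above on sets of finite measure.\<close>

lemma measure_enlargement_tendsto:
  fixes L :: "'a::euclidean_space set"
  assumes "compact L"
  shows "(\<lambda>n. measure lebesgue (L + cball 0 (inverse (real (Suc n))))) \<longlonglongrightarrow> measure lebesgue L"
proof -
  define A where "A n = L + cball 0 (inverse (real (Suc n)))" for n
  have lm: "A n \<in> lmeasurable" for n
    unfolding A_def using assms by (intro lmeasurable_compact compact_plus) auto
  have "decseq A"
  proof -
    have *: "inverse (real (Suc (Suc n))) \<le> inverse (real (Suc n))" for n
      by (intro le_imp_inverse_le) auto
    then show ?thesis unfolding A_def
      by (intro decseq_SucI set_plus_mono2 order_refl subset_cball *)
  qed
  moreover have "range A \<subseteq> sets lebesgue" using lm by (auto simp: fmeasurableD)
  moreover have "emeasure lebesgue (A n) \<noteq> \<infinity>" for n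
    using lm[of n] by (auto simp: fmeasurable_def)
  ultimately have "(\<lambda>n. measure lebesgue (A n)) \<longlonglongrightarrow> measure lebesgue (\<Inter>n. A n)"
    by (intro Lim_measure_decseq)
  moreover have "(\<Inter>n. A n) = L"
  proof (intro set_eqI iffI)
    fix x assume x: "x \<in> (\<Inter>n. A n)"
    show "x \<in> L"
    proof (rule in_closed_if_in_all_enlargements[OF compact_imp_closed[OF assms]])
      fix e :: real assume "e > 0"
      then obtain n where "inverse (real (Suc n)) < e" using reals_Archimedean by blast
      then have "A n \<subseteq> L + cball 0 e" unfolding A_def by (intro set_plus_mono2) auto
      then show "x \<in> L + cball 0 e" using x by blast
    qed
  next
    fix x assume "x \<in> L"
    then show "x \<in> (\<Inter>n. A n)" unfolding A_def plus_cball_eq by (auto intro: bexI[of _ x])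
  qed
  ultimately show ?thesis by (simp add: A_def)
qed

text \<open>If \<open>L\<close> has interior, then cancelling a ball from
  \<open>(1 - l) L + l cball x r \<subseteq> L \<subseteq> K n + cball 0 (l * r)\<close> puts a translate of \<open>(1 - l) L\<close> into \<open>K n\<close>.\<close>

lemma measure_hconv:
  fixes K :: "nat \<Rightarrow> 'a::euclidean_space set"
  assumes conv: "hconv K L" and K: "\<And>n. compact (K n)" "\<And>n. convex (K n)" and L: "compact L" "convex L"
  shows "(\<lambda>n. measure lebesgue (K n)) \<longlonglongrightarrow> measure lebesgue L"
proof (rule order_tendstoI)
  fix a assume a: "measure lebesgue L < a"
  obtain m where m: "measure lebesgue (L + cball 0 (inverse (real (Suc m)))) < a"
    using order_tendstoD(2)[OF measure_enlargement_tendsto[OF L(1)] a]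
    by (meson eventually_sequentially order_refl)
  define e where "e = inverse (real (Suc m))"
  have "e > 0" by (simp add: e_def)
  then have "\<forall>\<^sub>F n in sequentially. K n \<subseteq> L + cball 0 e \<and> L \<subseteq> K n + cball 0 e"
    using conv unfolding hconv_def by blast
  then show "\<forall>\<^sub>F n in sequentially. measure lebesgue (K n) < a"
  proof eventually_elim
    case (elim n)
    have "measure lebesgue (K n) \<le> measure lebesgue (L + cball 0 e)"
      using elim K L by (intro measure_mono_fmeasurable lmeasurable_compact compact_plus fmeasurableD) auto
    then show ?case using m by (simp add: e_def)
  qed
next
  fix a assume a: "a < measure lebesgue L"
  show "\<forall>\<^sub>F n in sequentially. a < measure lebesgue (K n)"
  proof (cases "interior L = {}")
    case True
    \<comment> \<open>A convex set with empty interior is null, so \<open>a\<close> is negative in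
      this case.\<close>
    then have "negligible L" using negligible_convex_interior L(2) by blast
    then have "measure lebesgue L = 0" by (rule negligible_imp_measure0)
    then have "a < measure lebesgue (K n)" for n
      using a measure_nonneg[of lebesgue "K n"] by linarith
    then show ?thesis by simp
  next
    case False
    then obtain x r where r: "r > 0" "cball x r \<subseteq> L" by (meson ex_in_conv mem_interior_cball)
    \<comment> \<open>Shrinking by a factor close to 1 keeps the volume above
      \<open>a\<close>.\<close>
    have "((\<lambda>l. \<bar>1 - l\<bar> ^ DIM('a) * measure lebesgue L) \<longlongrightarrow> \<bar>1 - 0\<bar> ^ DIM('a) * measure lebesgue L) (at_right (0::real))"
      by (intro tendsto_intros)
    then have "\<forall>\<^sub>F l in at_right (0::real). a < \<bar>1 - l\<bar> ^ DIM('a) * measure lebesgue L"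
      using a by (intro order_tendstoD(1)) auto
    moreover have "\<forall>\<^sub>F l in at_right (0::real). 0 < l \<and> l < 1"
      by (simp add: eventually_at_right_field) (use zero_less_one in blast)
    ultimately have "\<forall>\<^sub>F l in at_right (0::real). (0 < l \<and> l < 1) \<and> a < \<bar>1 - l\<bar> ^ DIM('a) * measure lebesgue L"
      by eventually_elim simp
    then obtain l where l: "0 < l" "l < 1" "a < \<bar>1 - l\<bar> ^ DIM('a) * measure lebesgue L"
      using eventually_happens trivial_limit_at_right_real by blast
    define X where "X = {l *\<^sub>R x} + (*\<^sub>R) (1 - l) ` L"
    have mX: "measure lebesgue X = \<bar>1 - l\<bar> ^ DIM('a) * measure lebesgue L"
      by (simp add: X_def measure_singleton_plus measure_scaleR_image)
    have XL: "X + cball 0 (l * r) \<subseteq> L"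
    proof
      fix z assume "z \<in> X + cball 0 (l * r)"
      then obtain y w where z: "z = l *\<^sub>R x + (1 - l) *\<^sub>R y + w" "y \<in> L" "norm w \<le> l * r"
        by (auto simp: X_def set_plus_def)
      \<comment> \<open>The vector \<open>(1 / l) *\<^sub>R w\<close> has norm at most
        \<open>r\<close>, so \<open>z\<close> is a convex combination of a point of the inner ball
        and \<open>y\<close>.\<close>
      have "x + (1 / l) *\<^sub>R w \<in> L"
        using z(3) l r by (intro subsetD[OF r(2)]) (auto simp: dist_norm field_simps)
      then have "l *\<^sub>R (x + (1 / l) *\<^sub>R w) + (1 - l) *\<^sub>R y \<in> L"
        using l z(2) by (intro convexD[OF L(2)]) auto
      then show "z \<in> L" using l by (simp add: z(1) algebra_simps)
    qed
    have "\<forall>\<^sub>F n in sequentially. K n \<subseteq> L + cball 0 (l * r) \<and> L \<subseteq> K n + cball 0 (l * r)"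
      using conv l r unfolding hconv_def by simp
    then show ?thesis
    proof eventually_elim
      case (elim n)
      have "X + cball 0 (l * r) \<subseteq> K n + cball 0 (l * r)" using XL elim by blast
      then have "X \<subseteq> K n"
        by (rule plus_cball_cancel) (use K l r in \<open>auto intro: compact_imp_closed\<close>)
      then have "measure lebesgue X \<le> measure lebesgue (K n)"
        using K L by (intro measure_mono_fmeasurable lmeasurable_compact fmeasurableD)
          (auto simp: X_def intro!: compact_plus compact_scaling)
      then show ?case using l mX by simp
    qed
  qed
qed

text \<open>Compactness makes the suprema range over bounded sets, so that they dominate each
  \<open>infdist\<close>, and provides nearest points.\<close>

lemma hausdorff_dist_imp_subset:
  fixes S T :: "'a::euclidean_space set"
  assumes "compact S" "compact T" "S \<noteq> {}" "T \<noteq> {}" "hausdorff_dist S T \<le> e"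
  shows "S \<subseteq> T + cball 0 e" "T \<subseteq> S + cball 0 e"
proof -
  have *: "A \<subseteq> B + cball 0 e"
    if A: "compact A" and B: "compact B" "B \<noteq> {}" and le: "(SUP x\<in>A. infdist x B) \<le> e" for A B :: "'a set"
  proof
    fix x assume x: "x \<in> A"
    have "bounded ((\<lambda>x. infdist x B) ` A)"
      using A by (intro compact_imp_bounded compact_continuous_image continuous_intros)
    then have "infdist x B \<le> (SUP x\<in>A. infdist x B)"
      using x by (intro cSUP_upper bounded_imp_bdd_above)
    then have "infdist x B \<le> e" using le by simp
    moreover obtain y where "y \<in> B" "infdist x B = dist x y"
      using infdist_attains_inf[of B x] B compact_imp_closed by blast
    ultimately show "x \<in> B + cball 0 e"
      unfolding plus_cball_eq by (auto simp: dist_commute)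
  qed
  show "S \<subseteq> T + cball 0 e" "T \<subseteq> S + cball 0 e"
    using assms *[of S T] *[of T S] unfolding hausdorff_dist_def by auto
qed

lemma zonoidE:
  fixes K :: "'a::euclidean_space set"
  assumes "zonoid K"
  obtains Z vs where "\<And>n. zonotope_of (Z n) (vs n)" "hconv Z K" "compact K" "convex K"
proof -
  obtain Z where K: "compact K" "K \<noteq> {}" and Z: "\<And>n. zonotope (Z n)" "(\<lambda>n. hausdorff_dist (Z n) K) \<longlonglongrightarrow> 0"
    using assms by (auto simp: zonoid_def)
  have "\<forall>n. \<exists>vs. zonotope_of (Z n) vs" using Z(1) zonotope_imp_zonotope_of by metis
  then obtain vs where vs: "\<And>n. zonotope_of (Z n) (vs n)" by metis
  have conv: "hconv Z K"
    unfolding hconv_def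
  proof (intro allI impI)
    fix e :: real assume "e > 0"
    then have "\<forall>\<^sub>F n in sequentially. hausdorff_dist (Z n) K < e"
      using Z(2) by (rule order_tendstoD(2)[rotated])
    then show "\<forall>\<^sub>F n in sequentially. Z n \<subseteq> K + cball 0 e \<and> K \<subseteq> Z n + cball 0 e"
    proof eventually_elim
      case (elim n)
      then show ?case
        using hausdorff_dist_imp_subset[of "Z n" K e] zonotope_of_convex_compact[OF vs[of n]] K by simp
    qed
  qed
  moreover have "convex K"
    using conv compact_imp_closed[OF K(1)] zonotope_of_convex_compact(1)[OF vs] by (rule convex_hconv_limit)
  ultimately show ?thesis using that vs K by blast
qed

section \<open>The ball as a limit of zonotopes\<close>

text \<open>Segments centred at the origin give a support function that is a plain sum of the
  absolute values \<open>\<bar>inner u v\<bar>\<close>.\<close>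

definition symzon :: "'a::euclidean_space list \<Rightarrow> 'a set" where
  "symzon vs = (\<Sum>v\<leftarrow>vs. closed_segment (- v) v)"

lemma zonotope_of_symzon: "zonotope_of (symzon vs) (map ((*\<^sub>R) 2) vs)"
proof (induction vs)
  case Nil
  show ?case by (simp add: symzon_def zonotope_of_def)
next
  case (Cons v vs)
  have "closed_segment (- v) v = {- v} + closed_segment 0 (2 *\<^sub>R v)"
    using closed_segment_translation[of "- v" 0 "2 *\<^sub>R v"] by (simp add: singleton_plus scaleR_2)
  then have "zonotope_of (closed_segment (- v) v) [2 *\<^sub>R v]"
    unfolding zonotope_of_def by (intro exI[of _ "- v"]) simp
  from zonotope_of_plus[OF this Cons.IH] show ?case by (simp add: symzon_def)
qed

lemma symzon_support_le: "z \<in> symzon vs \<Longrightarrow> inner u z \<le> (\<Sum>v\<leftarrow>vs. \<bar>inner u v\<bar>)"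
proof (induction vs arbitrary: z)
  case (Cons v vs)
  obtain a b where z: "z = a + b" "a \<in> closed_segment (- v) v" "b \<in> symzon vs"
    using Cons.prems by (auto simp: symzon_def set_plus_def)
  obtain t where t: "0 \<le> t" "t \<le> 1" "a = (1 - t) *\<^sub>R (- v) + t *\<^sub>R v"
    using z(2) by (auto simp: closed_segment_def)
  have "inner u a = (2 * t - 1) * inner u v" by (simp add: t(3) inner_diff_right algebra_simps)
  also have "\<dots> \<le> \<bar>2 * t - 1\<bar> * \<bar>inner u v\<bar>" by (metis abs_ge_self abs_mult)
  also have "\<dots> \<le> 1 * \<bar>inner u v\<bar>" using t by (intro mult_right_mono) auto
  finally show ?case using Cons.IH[OF z(3)] by (simp add: z(1) inner_add_right)
qed (simp add: symzon_def)

lemma symzon_support_attained: "\<exists>z\<in>symzon vs. inner u z = (\<Sum>v\<leftarrow>vs. \<bar>inner u v\<bar>)"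
proof (induction vs)
  case (Cons v vs)
  then obtain z where z: "z \<in> symzon vs" "inner u z = (\<Sum>v\<leftarrow>vs. \<bar>inner u v\<bar>)" by blast
  define a where "a = (if inner u v \<ge> 0 then v else - v)"
  have "a \<in> closed_segment (- v) v" "inner u a = \<bar>inner u v\<bar>" by (auto simp: a_def)
  then show ?case using z
    by (intro bexI[of _ "a + z"]) (auto simp: symzon_def inner_add_right intro: set_plus_intro)
qed (simp add: symzon_def)

text \<open>The support function of the unit ball is 1 on the sphere, and closeness of support
  functions is closeness of convex bodies: a point too far out is moved radially, and a missed point
  of the ball is refuted by a separating direction.\<close>

lemma symzon_near_ball:
  fixes vs :: "'a::euclidean_space list"
  assumes e: "e \<ge> 0" and h: "\<And>u. norm u = 1 \<Longrightarrow> \<bar>(\<Sum>v\<leftarrow>vs. \<bar>inner u v\<bar>) - 1\<bar> \<le> e"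
  shows "symzon vs \<subseteq> cball 0 1 + cball 0 e" "cball 0 1 \<subseteq> symzon vs + cball 0 e"
proof -
  show "symzon vs \<subseteq> cball 0 1 + cball 0 e"
  proof
    fix z assume z: "z \<in> symzon vs"
    show "z \<in> cball 0 1 + cball 0 e"
    proof (cases "norm z \<le> 1")
      case True
      then show ?thesis using e unfolding plus_cball_eq by (auto intro!: bexI[of _ z])
    next
      case False
      then have nz: "z \<noteq> 0" "norm (sgn z) = 1" by (auto simp: norm_sgn)
      have "norm z = inner (sgn z) z"
        using nz(1) by (simp add: sgn_div_norm power2_norm_eq_inner[symmetric] power2_eq_square)
      also have "\<dots> \<le> 1 + e" using symzon_support_le[OF z, of "sgn z"] h[OF nz(2)] by linarith
      finally have le: "norm z \<le> 1 + e" .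
      have "sgn z - z = (1 - norm z) *\<^sub>R sgn z"
        using nz(1) by (simp add: scaleR_left_diff_distrib) (simp add: sgn_div_norm)
      then have "dist (sgn z) z = \<bar>1 - norm z\<bar>" using nz(2) by (simp add: dist_norm)
      then have "dist (sgn z) z \<le> e" using le False by simp
      then show ?thesis unfolding plus_cball_eq using nz(2) by (auto intro!: bexI[of _ "sgn z"])
    qed
  qed
  show "cball 0 1 \<subseteq> symzon vs + cball 0 e"
  proof
    fix x :: 'a assume x: "x \<in> cball 0 1"
    show "x \<in> symzon vs + cball 0 e"
    proof (rule ccontr)
      assume nin: "x \<notin> symzon vs + cball 0 e"
      have S: "convex (symzon vs)" "compact (symzon vs)" "symzon vs \<noteq> {}"
        using zonotope_of_convex_compact[OF zonotope_of_symzon] by blast+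
      have "convex (symzon vs + cball 0 e)" "closed (symzon vs + cball 0 e)"
        using S by (auto intro!: convex_set_plus compact_imp_closed compact_plus)
      from separating_hyperplane_closed_point[OF this nin]
      obtain a b where ab: "inner a x < b" "\<And>y. y \<in> symzon vs + cball 0 e \<Longrightarrow> inner a y > b" by blast
      obtain s where "s \<in> symzon vs" using S by blast
      moreover have "symzon vs \<subseteq> symzon vs + cball 0 e"
        using set_zero_plus2[of "cball 0 e" "symzon vs"] e by (simp add: add.commute)
      ultimately have "inner a s > b" using ab(2) by blast
      then have a: "a \<noteq> 0" using ab(1) by auto
      \<comment> \<open>The enlarged zonotope lies on the greater side of the hyperplane, so the
        outer normal is \<open>- sgn a\<close>. There its support value is at least 1, yet
        \<open>inner u x \<le> 1\<close>.\<close>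
      define u where "u = - sgn a"
      have u: "norm u = 1" using a by (simp add: u_def norm_sgn)
      have au: "inner a y = - (norm a * inner u y)" for y
        using a by (simp add: u_def sgn_div_norm)
      obtain z where z: "z \<in> symzon vs" "inner u z = (\<Sum>v\<leftarrow>vs. \<bar>inner u v\<bar>)"
        using symzon_support_attained by blast
      have "z + e *\<^sub>R u \<in> symzon vs + cball 0 e"
        using z(1) u e by (intro set_plus_intro) auto
      then have "inner a (z + e *\<^sub>R u) > b" by (rule ab(2))
      then have "norm a * inner u (z + e *\<^sub>R u) < norm a * inner u x" using ab(1) by (simp add: au)
      then have "inner u (z + e *\<^sub>R u) < inner u x" using a by simp
      moreover have "inner u (z + e *\<^sub>R u) = inner u z + e"
        using u by (simp add: inner_add_right power2_norm_eq_inner[symmetric])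
      moreover have "inner u z \<ge> 1 - e" using z(2) h[OF u] by linarith
      moreover have "inner u x \<le> 1" using norm_cauchy_schwarz[of u x] u x by simp
      ultimately show False by linarith
    qed
  qed
qed

text \<open>Uniform continuity of \<open>g\<close> makes one tagged division work for all \<open>u\<close>.\<close>

lemma integral_abs_inner_approx:
  fixes g :: "'a::euclidean_space \<Rightarrow> 'b::euclidean_space"
  assumes g: "continuous_on (cbox a b) g" and e: "e > 0"
  shows "\<exists>vs. \<forall>u. norm u \<le> 1 \<longrightarrow>
    \<bar>(\<Sum>v\<leftarrow>vs. \<bar>inner u v\<bar>) - integral (cbox a b) (\<lambda>v. \<bar>inner u (g v)\<bar>)\<bar> \<le> e"
proof -
  \<comment> \<open>The summand 1 allows for a box of content 0.\<close>
  define d where "d = e / (measure lborel (cbox a b) + 1)"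
  have "e / (c + 1) > 0 \<and> e / (c + 1) * c \<le> e" if "c \<ge> 0" for c
    using e that by (simp add: field_simps)
  from this[OF measure_nonneg] have d: "d > 0" "d * measure lborel (cbox a b) \<le> e"
    unfolding d_def by blast+
  obtain r where r: "r > 0" "\<And>v v'. v \<in> cbox a b \<Longrightarrow> v' \<in> cbox a b \<Longrightarrow> dist v' v < r \<Longrightarrow> dist (g v') (g v) < d"
    using compact_uniformly_continuous[OF g compact_cbox] d(1) unfolding uniformly_continuous_on_def by metis
  obtain p where p: "p tagged_division_of cbox a b" "(\<lambda>x. ball x r) fine p"
    using fine_division_exists[OF gauge_ball[OF r(1)]] by blast
  obtain xs where xs: "set xs = p" "distinct xs"
    using finite_distinct_list p(1) by blast
  \<comment> \<open>With these vectors the sum of \<open>\<bar>inner u v\<bar>\<close> is the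
    Riemann sum of the integral, for every \<open>u\<close> at once.\<close>
  define vs where "vs = map (\<lambda>(x, k). measure lborel k *\<^sub>R g x) xs"
  have "\<bar>(\<Sum>v\<leftarrow>vs. \<bar>inner u v\<bar>) - integral (cbox a b) (\<lambda>v. \<bar>inner u (g v)\<bar>)\<bar> \<le> e" if u: "norm u \<le> 1" for u
  proof -
    define f where "f v = \<bar>inner u (g v)\<bar>" for v
    have f: "continuous_on (cbox a b) f" unfolding f_def by (intro continuous_intros g)
    have flip: "\<bar>f v - f v'\<bar> \<le> dist (g v) (g v')" for v v'
    proof -
      have "\<bar>f v - f v'\<bar> \<le> \<bar>inner u (g v - g v')\<bar>" by (simp add: f_def inner_diff_right)
      also have "\<dots> \<le> norm u * norm (g v - g v')" by (rule Cauchy_Schwarz_ineq2)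
      also have "\<dots> \<le> 1 * norm (g v - g v')" using u by (intro mult_right_mono) auto
      finally show ?thesis by (simp add: dist_norm)
    qed
    have "(\<Sum>v\<leftarrow>vs. \<bar>inner u v\<bar>) = (\<Sum>(x, k)\<in>p. measure lborel k * f x)"
      using xs by (simp add: vs_def o_def case_prod_beta abs_mult f_def sum_list_distinct_conv_sum_set)
    moreover have "integral (cbox a b) f = (\<Sum>(x, k)\<in>p. integral k f)"
      by (rule integral_combine_tagged_division_topdown[OF integrable_continuous[OF f] p(1)])
    ultimately have "\<bar>(\<Sum>v\<leftarrow>vs. \<bar>inner u v\<bar>) - integral (cbox a b) f\<bar> = \<bar>\<Sum>(x, k)\<in>p. measure lborel k * f x - integral k f\<bar>"
      by (simp add: sum_subtractf case_prod_beta)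
    also have "\<dots> \<le> (\<Sum>(x, k)\<in>p. \<bar>measure lborel k * f x - integral k f\<bar>)"
      using sum_abs[of "\<lambda>(x, k). measure lborel k * f x - integral k f" p] by (simp add: case_prod_beta)
    also have "\<dots> \<le> (\<Sum>(x, k)\<in>p. d * measure lborel k)"
    proof (intro sum_mono, clarify)
      fix x k assume xk: "(x, k) \<in> p"
      have k: "x \<in> k" "k \<subseteq> cbox a b" "\<exists>l m. k = cbox l m"
        using tagged_division_ofD(2-4)[OF p(1) xk] by auto
      then obtain l m where lm: "k = cbox l m" by blast
      have kb: "k \<subseteq> ball x r" using p(2) xk by (auto simp: fine_def)
      have fk: "f integrable_on k"
        unfolding lm by (intro integrable_continuous continuous_on_subset[OF f]) (use k lm in auto)
      have "((\<lambda>v. f x - f v) has_integral (measure lborel k * f x - integral k f)) (cbox l m)"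
        using has_integral_diff[OF has_integral_const[of "f x" l m] integrable_integral[OF fk[unfolded lm]]]
        by (simp add: lm)
      moreover have "norm (f x - f v) \<le> d" if "v \<in> cbox l m" for v
      proof -
        have "v \<in> cbox a b" "x \<in> cbox a b" "dist x v < r" using that k kb lm by auto
        then have "dist (g x) (g v) < d" using r(2)[of v x] by simp
        then show ?thesis using flip[of x v] by simp
      qed
      ultimately have "norm (measure lborel k * f x - integral k f) \<le> d * measure lborel (cbox l m)"
        using d(1) by (intro has_integral_bound) auto
      then show "\<bar>measure lborel k * f x - integral k f\<bar> \<le> d * measure lborel k" by (simp add: lm)
    qed
    also have "\<dots> = d * measure lborel (cbox a b)"
      using additive_content_tagged_division[OF p(1)] by (simp add: case_prod_beta sum_distrib_left[symmetric])
    also have "\<dots> \<le> e" by (rule d(2))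
    finally show ?thesis by (simp add: f_def[abs_def])
  qed
  then show ?thesis by blast
qed

text \<open>An orthogonal map preserves the ball and has determinant 1 or -1, so the linear change
  of variables leaves the integral unchanged.\<close>

lemma integral_orthogonal_transformation_cball:
  fixes f :: "real^'n::{finite,wellorder} \<Rightarrow> real" and T :: "real^'n::_ \<Rightarrow> real^'n::_"
  assumes T: "orthogonal_transformation T" and f: "continuous_on UNIV f"
  shows "integral (cball 0 1) (\<lambda>x. f (T x)) = integral (cball 0 1) f"
proof -
  \<comment> \<open>The change of variables is applied to vector-valued integrands, so
    \<open>f\<close> becomes the only component of \<open>F\<close>.\<close>
  define F where "F x = (\<chi> i::1. f x)" for x
  have contF: "continuous_on UNIV F" unfolding F_def by (intro continuous_intros f)
  have ai: "h absolutely_integrable_on cball 0 1" if h: "continuous_on UNIV h" for h :: "real^'n::_ \<Rightarrow> real^1"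
  proof -
    obtain a where a: "cball 0 1 \<subseteq> cbox (- a) (a :: real^'n::_)"
      using bounded_subset_cbox_symmetric[OF bounded_cball] by blast
    have "h absolutely_integrable_on cbox (- a) a"
      by (intro absolutely_integrable_continuous continuous_on_subset[OF h]) auto
    then show ?thesis by (rule set_integrable_subset) (use a in auto)
  qed
  have lin: "linear T" using T by (rule orthogonal_transformation_linear)
  have contFT: "continuous_on UNIV (F \<circ> T)"
    using lin by (intro continuous_on_compose continuous_on_subset[OF contF]) (auto simp: linear_continuous_on linear_conv_bounded_linear)
  have "integral (T ` cball 0 1) F = \<bar>det (matrix T)\<bar> *\<^sub>R integral (cball 0 1) (F \<circ> T)"
    using ai[OF contFT] by (intro integral_change_of_variables_linear lin) auto
  moreover have "T ` cball 0 1 = cball 0 1"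
    using image_orthogonal_transformation_cball[OF T, of 0 1] lin by (simp add: linear_0)
  moreover have "\<bar>det (matrix T)\<bar> = 1"
    using T det_orthogonal_matrix[of "matrix T"] by (auto simp: orthogonal_transformation_matrix)
  ultimately have eq: "integral (cball 0 1) F = integral (cball 0 1) (F \<circ> T)" by simp
  have comp: "integral (cball 0 1) (\<lambda>x. h x $ 1) = integral (cball 0 1) h $ 1"
    if "continuous_on UNIV h" for h :: "real^'n::_ \<Rightarrow> real^1"
    using ai[OF that] by (intro integral_component_eq_cart set_lebesgue_integral_eq_integral(1))
  show ?thesis using comp[OF contF] comp[OF contFT] eq by (simp add: F_def)
qed

text \<open>Integrating \<open>\<bar>inner u v\<bar>\<close> against a radial weight gives a
  rotation-invariant function of \<open>u\<close>, constant on the sphere. After normalization its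
  Riemann sums are support functions of zonotopes tending uniformly to 1.\<close>

lemma cball_limit_of_zonotopes:
  obtains Z :: "nat \<Rightarrow> (real^'n::{finite,wellorder}) set" and vs
  where "\<And>n. zonotope_of (Z n) (vs n)" "hconv Z (cball 0 1)"
proof -
  \<comment> \<open>A continuous weight vanishing outside the unit ball: the integral over the box,
    fit for tagged divisions, equals the one over the ball, fit for rotations.\<close>
  define \<phi> where "\<phi> v = max 0 (1 - norm v)" for v :: "real^'n::_"
  define f where "f u v = \<bar>inner u (\<phi> v *\<^sub>R v)\<bar>" for u v :: "real^'n::_"
  have \<phi>: "continuous_on S \<phi>" for S unfolding \<phi>_def by (intro continuous_intros)
  have f: "continuous_on S (f u)" for S u unfolding f_def by (intro continuous_intros \<phi>)
  obtain a where a: "cball 0 1 \<subseteq> cbox (- a) (a :: real^'n::_)"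
    using bounded_subset_cbox_symmetric[OF bounded_cball] by blast
  define F where "F u = integral (cbox (- a) a) (f u)" for u
  have F: "F u = integral (cball 0 1) (f u)" for u
  proof -
    have "(\<lambda>x. if x \<in> cbox (- a) a then f u x else 0) = (\<lambda>x. if x \<in> cball 0 1 then f u x else 0)"
      using a by (auto simp: f_def \<phi>_def fun_eq_iff)
    from arg_cong[OF this, of "integral UNIV"] show ?thesis
      unfolding F_def integral_restrict_UNIV .
  qed
  define w :: "real^'n::_" where "w = axis undefined 1"
  have w: "norm w = 1" by (simp add: w_def)
  define C where "C = F w"
  have FC: "F u = C" if u: "norm u = 1" for u
  proof -
    obtain T where T: "orthogonal_transformation T" "T w = u"
      by (rule orthogonal_transformation_exists[of w u]) (use u w in auto)
    have "f u (T x) = f w x" for x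
      using T by (simp add: f_def \<phi>_def orthogonal_transformation_norm flip: T(2)) (simp add: orthogonal_transformation_def)
    then show ?thesis
      using integral_orthogonal_transformation_cball[OF T(1) f[of UNIV u]] by (simp add: F C_def)
  qed
  \<comment> \<open>Otherwise the continuous nonnegative integrand would vanish on the whole box,
    but it is positive at \<open>(1/2) *\<^sub>R w\<close>.\<close>
  have "C > 0"
  proof (rule ccontr)
    assume "\<not> C > 0"
    moreover have "C \<ge> 0" unfolding C_def F_def
      by (intro integral_nonneg integrable_continuous f) (simp add: f_def)
    ultimately have "((f w) has_integral 0) (cbox (- a) a)"
      using integrable_integral[OF integrable_continuous[OF f]] unfolding C_def F_def by (metis linorder_le_less_linear order_antisym)
    moreover have "(1/2) *\<^sub>R w \<in> cbox (- a) a" using a w by auto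
    moreover have "box (- a) a \<noteq> {}"
    proof -
      have "ball 0 1 \<subseteq> interior (cbox (- a) a)"
        using a by (intro interior_maximal) auto
      then show ?thesis by (auto simp: interior_cbox)
    qed
    ultimately have "f w ((1/2) *\<^sub>R w) = 0"
      by (intro has_integral_0_cbox_imp_0[of "- a" a "f w"] f) (auto simp: f_def)
    then show False using w by (simp add: f_def \<phi>_def power2_norm_eq_inner[symmetric])
  qed
  have "\<exists>vs :: (real^'n::_) list. \<forall>u. norm u = 1 \<longrightarrow> \<bar>(\<Sum>v\<leftarrow>vs. \<bar>inner u v\<bar>) - 1\<bar> \<le> e" if e: "e > 0" for e
  proof -
    have "continuous_on (cbox (- a) a) (\<lambda>v. (1 / C) *\<^sub>R (\<phi> v *\<^sub>R v))" by (intro continuous_intros \<phi>)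
    from integral_abs_inner_approx[OF this e] obtain vs where
      vs: "\<And>u. norm u \<le> 1 \<Longrightarrow> \<bar>(\<Sum>v\<leftarrow>vs. \<bar>inner u v\<bar>) - integral (cbox (- a) a) (\<lambda>v. \<bar>inner u ((1 / C) *\<^sub>R (\<phi> v *\<^sub>R v))\<bar>)\<bar> \<le> e"
      by blast
    have one: "integral (cbox (- a) a) (\<lambda>v. \<bar>inner u ((1 / C) *\<^sub>R (\<phi> v *\<^sub>R v))\<bar>) = 1" if "norm u = 1" for u
    proof -
      have "(\<lambda>v. \<bar>inner u ((1 / C) *\<^sub>R (\<phi> v *\<^sub>R v))\<bar>) = (\<lambda>v. (1 / C) * f u v)"
        using \<open>C > 0\<close> by (simp add: f_def fun_eq_iff abs_mult)
      then show ?thesis using FC[OF that] \<open>C > 0\<close> by (simp add: F_def)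
    qed
    show ?thesis
    proof (intro exI allI impI)
      fix u :: "real^'n::_" assume u: "norm u = 1"
      show "\<bar>(\<Sum>v\<leftarrow>vs. \<bar>inner u v\<bar>) - 1\<bar> \<le> e"
        using vs[of u] unfolding one[OF u] by (simp add: u)
    qed
  qed
  then have "\<exists>vs :: (real^'n::_) list. \<forall>u. norm u = 1 \<longrightarrow> \<bar>(\<Sum>v\<leftarrow>vs. \<bar>inner u v\<bar>) - 1\<bar> \<le> inverse (real (Suc n))" for n
    by simp
  then obtain vs :: "nat \<Rightarrow> (real^'n::_) list" where
    vs: "\<And>n u. norm u = 1 \<Longrightarrow> \<bar>(\<Sum>v\<leftarrow>vs n. \<bar>inner u v\<bar>) - 1\<bar> \<le> inverse (real (Suc n))" by metis
  have "hconv (\<lambda>n. symzon (vs n)) (cball 0 1)"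
    unfolding hconv_def
  proof (intro allI impI)
    fix e :: real assume "e > 0"
    then have "\<forall>\<^sub>F n in sequentially. inverse (real (Suc n)) < e"
      using LIMSEQ_inverse_real_of_nat by (rule order_tendstoD(2)[rotated])
    then show "\<forall>\<^sub>F n in sequentially. symzon (vs n) \<subseteq> cball 0 1 + cball 0 e \<and> cball 0 1 \<subseteq> symzon (vs n) + cball 0 e"
    proof eventually_elim
      case (elim n)
      then have "\<bar>(\<Sum>v\<leftarrow>vs n. \<bar>inner u v\<bar>) - 1\<bar> \<le> e" if "norm u = 1" for u
        using vs[OF that, of n] by linarith
      then show ?case using symzon_near_ball[of e "vs n"] \<open>e > 0\<close> by simp
    qed
  qed
  then show ?thesis by (rule that[OF zonotope_of_symzon])
qed

section \<open>Mixed volumes and surface area\<close>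

text \<open>Merges the two copies of \<open>K\<close> in the body whose volume defines
  \<open>mixed_volume K K M\<close>.\<close>

lemma convex_scaleR_add:
  fixes K :: "'a::real_vector set"
  assumes "convex K" "0 \<le> s" "0 \<le> t"
  shows "(*\<^sub>R) s ` K + (*\<^sub>R) t ` K = (*\<^sub>R) (s + t) ` K"
proof (intro set_eqI iffI)
  fix x assume "x \<in> (*\<^sub>R) s ` K + (*\<^sub>R) t ` K"
  then obtain y z where x: "x = s *\<^sub>R y + t *\<^sub>R z" "y \<in> K" "z \<in> K" by (auto simp: set_plus_def)
  show "x \<in> (*\<^sub>R) (s + t) ` K"
  proof (cases "s + t = 0")
    case True
    then have "s = 0" "t = 0" using assms by auto
    then show ?thesis using x by (auto intro!: image_eqI[of _ _ y])
  next
    case False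
    then have st: "s + t > 0" using assms by auto
    have "(s / (s + t)) *\<^sub>R y + (t / (s + t)) *\<^sub>R z \<in> K"
      using st assms x by (intro convexD) (auto simp: add_divide_distrib[symmetric])
    moreover have "x = (s + t) *\<^sub>R ((s / (s + t)) *\<^sub>R y + (t / (s + t)) *\<^sub>R z)"
      using st by (simp add: x(1) scaleR_add_right)
    ultimately show ?thesis by blast
  qed
next
  fix x assume "x \<in> (*\<^sub>R) (s + t) ` K"
  then show "x \<in> (*\<^sub>R) s ` K + (*\<^sub>R) t ` K"
    by (auto simp: scaleR_add_left intro: set_plus_intro)
qed

text \<open>Polarization: the alternating sum of a cubic form over the vertices of the unit cube is
  six times its coefficient at the indices 0, 1, 2.\<close>

lemma mixed_volume_eq:
  fixes a b c d :: real
  assumes K: "convex K"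
    and vol: "\<And>s t. 0 \<le> s \<Longrightarrow> 0 \<le> t \<Longrightarrow>
      vol ((*\<^sub>R) s ` K + (*\<^sub>R) t ` M) = a * s ^ 3 + b * s\<^sup>2 * t + c * s * t\<^sup>2 + d * t ^ 3"
  shows "mixed_volume K K M = b / 3"
proof -
  define Q where "Q s t = a * s ^ 3 + b * s\<^sup>2 * t + c * s * t\<^sup>2 + d * t ^ 3" for s t
  have Q: "vol (\<Sum>i<3. (\<lambda>x. t i *\<^sub>R x) ` ([K, K, M] ! i)) = Q (t 0 + t 1) (t 2)"
    if "\<forall>i. t i \<ge> 0" for t :: "nat \<Rightarrow> real"
  proof -
    have "(\<Sum>i<3. (\<lambda>x. t i *\<^sub>R x) ` ([K, K, M] ! i)) = (*\<^sub>R) (t 0 + t 1) ` K + (*\<^sub>R) (t 2) ` M"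
      using convex_scaleR_add[OF K, of "t 0" "t 1"] that by (simp add: eval_nat_numeral)
    then show ?thesis using vol that by (simp add: Q_def)
  qed
  have exp3: "(\<Sum>i<3. f i) = f 0 + f 1 + f 2" for f :: "nat \<Rightarrow> real"
    by (simp add: eval_nat_numeral)
  show ?thesis
    unfolding mixed_volume_def
  proof (rule the_equality)
    \<comment> \<open>Index 2 stands for \<open>M\<close>, and a symmetric coefficient depends only
      on how many indices equal 2. The multiplicities 1, 3, 3, 1 account for the divisions by
      3.\<close>
    define e where "e i = (if i = 2 then 1 else 0 :: nat)" for i :: nat
    define f where "f i j k = [a, b / 3, c / 3, d] ! (e i + e j + e k)" for i j k
    have "(\<forall>i j k. f i j k = f j i k \<and> f i j k = f i k j)"
      by (simp add: f_def add_ac)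
    moreover have "vol (\<Sum>i<3. (\<lambda>x. t i *\<^sub>R x) ` ([K, K, M] ! i)) = (\<Sum>i<3. \<Sum>j<3. \<Sum>k<3. f i j k * t i * t j * t k)"
      if "\<forall>i. t i \<ge> 0" for t
      unfolding Q[OF that] exp3 Q_def f_def e_def
      by (simp add: numeral_2_eq_2 numeral_3_eq_3 algebra_simps power2_eq_square power3_eq_cube)
    moreover have "b / 3 = f 0 1 2" by (simp add: f_def e_def)
    ultimately show "\<exists>c. (\<forall>i j k. c i j k = c j i k \<and> c i j k = c i k j) \<and>
       (\<forall>t. (\<forall>i. 0 \<le> t i) \<longrightarrow>
          vol (\<Sum>i<3. (\<lambda>x. t i *\<^sub>R x) ` ([K, K, M] ! i)) = (\<Sum>i<3. \<Sum>j<3. \<Sum>k<3. c i j k * t i * t j * t k)) \<and>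
       b / 3 = c 0 1 2" by blast
  next
    fix v assume "\<exists>c. (\<forall>i j k. c i j k = c j i k \<and> c i j k = c i k j) \<and>
       (\<forall>t. (\<forall>i. 0 \<le> t i) \<longrightarrow>
          vol (\<Sum>i<3. (\<lambda>x. t i *\<^sub>R x) ` ([K, K, M] ! i)) = (\<Sum>i<3. \<Sum>j<3. \<Sum>k<3. c i j k * t i * t j * t k)) \<and>
       v = c 0 1 2"
    then obtain f where sym: "\<And>i j k. f i j k = f j i k" "\<And>i j k. f i j k = f i k j"
      and f: "\<And>t. \<forall>i. 0 \<le> t i \<Longrightarrow>
          vol (\<Sum>i<3. (\<lambda>x. t i *\<^sub>R x) ` ([K, K, M] ! i)) = (\<Sum>i<3. \<Sum>j<3. \<Sum>k<3. f i j k * t i * t j * t k)"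
      and v: "v = f 0 1 2" by blast
    define S where "S t = (\<Sum>i<3. \<Sum>j<3. \<Sum>k<3. f i j k * t i * t j * t k)" for t :: "nat \<Rightarrow> real"
    define T where "T x y z = (\<lambda>i::nat. if i = 0 then x else if i = 1 then y else if i = 2 then z else 0)" for x y z :: real
    have ST: "S (T x y z) = Q (x + y) z" if "0 \<le> x" "0 \<le> y" "0 \<le> z" for x y z
    proof -
      have "\<forall>i. 0 \<le> T x y z i" using that by (simp add: T_def)
      from f[OF this] Q[OF this] show ?thesis by (simp add: S_def) (simp add: T_def)
    qed
    have perm: "f 0 2 1 = f 0 1 2" "f 1 0 2 = f 0 1 2" "f 1 2 0 = f 0 1 2" "f 2 0 1 = f 0 1 2" "f 2 1 0 = f 0 1 2"
      using sym(1)[of 0 1 2] sym(2)[of 0 1 2] sym(2)[of 1 0 2] sym(1)[of 0 2 1] sym(1)[of 1 2 0] by auto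
    have "S (T 1 1 1) - S (T 1 1 0) - S (T 1 0 1) - S (T 0 1 1) + S (T 1 0 0) + S (T 0 1 0) + S (T 0 0 1) = 6 * f 0 1 2"
      unfolding S_def exp3 using perm by (simp add: T_def)
    then have "6 * f 0 1 2 = 2 * b"
      by (simp add: ST Q_def)
    then show "v = b / 3" by (simp add: v)
  qed
qed

text \<open>The four coefficients are fixed linear combinations of the values at (1,0), (0,1), (1,1)
  and (2,1), so they converge with the form.\<close>

lemma cubic_form_limit:
  fixes g :: "nat \<Rightarrow> real \<Rightarrow> real \<Rightarrow> real"
  assumes g: "\<And>n s t. 0 \<le> s \<Longrightarrow> 0 \<le> t \<Longrightarrow> g n s t = a n * s ^ 3 + b n * s\<^sup>2 * t + c n * s * t\<^sup>2 + d n * t ^ 3"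
    and G: "\<And>s t. 0 \<le> s \<Longrightarrow> 0 \<le> t \<Longrightarrow> (\<lambda>n. g n s t) \<longlonglongrightarrow> G s t"
  obtains a' b' c' d' where
    "\<And>s t. 0 \<le> s \<Longrightarrow> 0 \<le> t \<Longrightarrow> G s t = a' * s ^ 3 + b' * s\<^sup>2 * t + c' * s * t\<^sup>2 + d' * t ^ 3"
    "b \<longlonglongrightarrow> b'"
proof -
  have a: "a = (\<lambda>n. g n 1 0)" and d: "d = (\<lambda>n. g n 0 1)" by (simp_all add: g fun_eq_iff)
  have b: "b = (\<lambda>n. (g n 2 1 - 6 * g n 1 0 + g n 0 1 - 2 * g n 1 1) / 2)"
    by (simp add: g fun_eq_iff)
  have c: "c = (\<lambda>n. g n 1 1 - g n 1 0 - g n 0 1 - (g n 2 1 - 6 * g n 1 0 + g n 0 1 - 2 * g n 1 1) / 2)"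
    by (simp add: g fun_eq_iff field_simps)
  have lim: "a \<longlonglongrightarrow> G 1 0" "d \<longlonglongrightarrow> G 0 1"
    "b \<longlonglongrightarrow> (G 2 1 - 6 * G 1 0 + G 0 1 - 2 * G 1 1) / 2"
    "c \<longlonglongrightarrow> G 1 1 - G 1 0 - G 0 1 - (G 2 1 - 6 * G 1 0 + G 0 1 - 2 * G 1 1) / 2"
    unfolding a d b c by (intro tendsto_intros G; simp)+
  show ?thesis
  proof (rule that[OF _ lim(3)])
    fix s t :: real assume st: "0 \<le> s" "0 \<le> t"
    have "(\<lambda>n. g n s t) \<longlonglongrightarrow> G 1 0 * s ^ 3 + (G 2 1 - 6 * G 1 0 + G 0 1 - 2 * G 1 1) / 2 * s\<^sup>2 * t
      + (G 1 1 - G 1 0 - G 0 1 - (G 2 1 - 6 * G 1 0 + G 0 1 - 2 * G 1 1) / 2) * s * t\<^sup>2 + G 0 1 * t ^ 3"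
      unfolding g[OF st] by (intro tendsto_intros lim)
    with G[OF st] show "G s t = G 1 0 * s ^ 3 + (G 2 1 - 6 * G 1 0 + G 0 1 - 2 * G 1 1) / 2 * s\<^sup>2 * t
      + (G 1 1 - G 1 0 - G 0 1 - (G 2 1 - 6 * G 1 0 + G 0 1 - 2 * G 1 1) / 2) * s * t\<^sup>2 + G 0 1 * t ^ 3"
      by (rule LIMSEQ_unique)
  qed
qed

lemma vol_zonotope_limit:
  assumes "\<And>n. zonotope_of (Z n) (vs n)" "hconv Z K" "compact K" "convex K"
  shows "(\<lambda>n. zvol (vs n)) \<longlonglongrightarrow> vol K"
  using measure_hconv[OF assms(2) zonotope_of_convex_compact(2)[OF assms(1)] zonotope_of_convex_compact(1)[OF assms(1)] assms(3,4)]
  by (simp add: zonotope_of_vol[OF assms(1)])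

text \<open>The surface area is the coefficient at \<open>s\<^sup>2 * t\<close> of the volume of
  \<open>s K + t U\<close>, with \<open>U\<close> the unit ball. For the approximating zonotopes
  this coefficient is half a determinant sum, and the coefficients converge.\<close>

lemma surface_area_limit:
  assumes Z: "\<And>n. zonotope_of (Z n) (vs n)" "hconv Z K" and K: "compact K" "convex K"
    and W: "\<And>n. zonotope_of (W n) (us n)" "hconv W (cball 0 1)"
  shows "(\<lambda>n. detsum (vs n) (vs n) (us n) / 2) \<longlonglongrightarrow> surface_area K"
proof -
  define g where "g n s t = zvol (map ((*\<^sub>R) s) (vs n) @ map ((*\<^sub>R) t) (us n))" for n s t
  define G where "G s t = vol ((*\<^sub>R) s ` K + (*\<^sub>R) t ` cball 0 1)" for s t
  have lim: "(\<lambda>n. g n s t) \<longlonglongrightarrow> G s t" for s t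
    unfolding g_def G_def
  proof (rule vol_zonotope_limit)
    show "zonotope_of ((*\<^sub>R) s ` Z n + (*\<^sub>R) t ` W n) (map ((*\<^sub>R) s) (vs n) @ map ((*\<^sub>R) t) (us n))" for n
      by (intro zonotope_of_plus zonotope_of_scaleR Z W)
    show "hconv (\<lambda>n. (*\<^sub>R) s ` Z n + (*\<^sub>R) t ` W n) ((*\<^sub>R) s ` K + (*\<^sub>R) t ` cball 0 1)"
      by (intro hconv_plus hconv_scaleR Z W)
    show "compact ((*\<^sub>R) s ` K + (*\<^sub>R) t ` cball 0 1)"
      by (intro compact_plus compact_scaling K compact_cball)
    show "convex ((*\<^sub>R) s ` K + (*\<^sub>R) t ` cball 0 1)"
      by (intro convex_set_plus convex_scaling K convex_cball)
  qed
  obtain a b c d where G: "\<And>s t. 0 \<le> s \<Longrightarrow> 0 \<le> t \<Longrightarrow> G s t = a * s ^ 3 + b * s\<^sup>2 * t + c * s * t\<^sup>2 + d * t ^ 3"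
    and b: "(\<lambda>n. detsum (vs n) (vs n) (us n) / 2) \<longlonglongrightarrow> b"
    using cubic_form_limit[OF zvol_combination[of _ _ "vs n" "us n" for n] lim[unfolded g_def]] by blast
  have "mixed_volume K K (cball 0 1) = b / 3"
    using G by (intro mixed_volume_eq[OF K(2)]) (simp add: G_def)
  then have "surface_area K = b" by (simp add: surface_area_def)
  then show ?thesis using b by simp
qed

text \<open>The first-order part at \<open>t = 0\<close> of log-submodularity for \<open>xs\<close>, \<open>ys\<close> and \<open>t us\<close>.\<close>

lemma detsum_zvol_le:
  "detsum (xs @ ys) (xs @ ys) us * zvol xs \<le> zvol (xs @ ys) * detsum xs xs us"
proof -
  \<comment> \<open>For \<open>t > 0\<close> this is the difference quotient of the volume when the
    generators \<open>t us\<close> are adjoined to \<open>zs\<close>.\<close>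
  define p where "p zs t = detsum zs zs us / 2 + detsum zs us us / 2 * t + zvol us * t\<^sup>2" for zs t
  have expand: "zvol (zs @ map ((*\<^sub>R) t) us) = zvol zs + t * p zs t" if "0 \<le> t" for zs t
  proof -
    have "map ((*\<^sub>R) 1) zs = zs" by (simp add: map_idI)
    then show ?thesis using zvol_combination[of 1 t zs us] that
      by (simp add: p_def algebra_simps power2_eq_square power3_eq_cube)
  qed
  \<comment> \<open>The terms of order 0 on both sides of log-submodularity agree, so a factor
    \<open>t\<close> can be divided out.\<close>
  have le: "p (xs @ ys) t * zvol xs \<le> zvol (xs @ ys) * p xs t" if t: "t > 0" for t
  proof -
    have "t * (p (xs @ ys) t * zvol xs) \<le> t * (zvol (xs @ ys) * p xs t)"
      using zvol_log_submodular[of xs ys "map ((*\<^sub>R) t) us"] expand[of t "xs @ ys"] expand[of t xs] t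
      by (simp add: algebra_simps)
    then show ?thesis using t by simp
  qed
  have lim: "((\<lambda>t. p zs t) \<longlongrightarrow> detsum zs zs us / 2) (at_right 0)" for zs
  proof -
    have "((\<lambda>t. p zs t) \<longlongrightarrow> detsum zs zs us / 2 + detsum zs us us / 2 * 0 + zvol us * 0\<^sup>2) (at_right 0)"
      unfolding p_def by (intro tendsto_intros)
    then show ?thesis by simp
  qed
  have "detsum (xs @ ys) (xs @ ys) us / 2 * zvol xs \<le> zvol (xs @ ys) * (detsum xs xs us / 2)"
  proof (rule tendsto_le[OF trivial_limit_at_right_real])
    show "((\<lambda>t. zvol (xs @ ys) * p xs t) \<longlongrightarrow> zvol (xs @ ys) * (detsum xs xs us / 2)) (at_right 0)"
      by (intro tendsto_intros lim)
    show "((\<lambda>t. p (xs @ ys) t * zvol xs) \<longlongrightarrow> detsum (xs @ ys) (xs @ ys) us / 2 * zvol xs) (at_right 0)"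
      by (intro tendsto_intros lim)
    show "\<forall>\<^sub>F t in at_right 0. p (xs @ ys) t * zvol xs \<le> zvol (xs @ ys) * p xs t"
      using le by (auto simp: eventually_at_right_field intro!: exI[of _ 1])
  qed
  then show ?thesis by simp
qed

theorem mainTheorem9:
  fixes A B :: "(real^3) set"
  assumes "zonoid A" and "zonoid B"
    and "surface_area A > 0"
  shows "vol (A + B) / surface_area (A + B) \<ge> vol A / surface_area A"
proof -
  obtain ZA as where A: "\<And>n. zonotope_of (ZA n) (as n)" "hconv ZA A" "compact A" "convex A"
    using zonoidE[OF assms(1)] by blast
  obtain ZB bs where B: "\<And>n. zonotope_of (ZB n) (bs n)" "hconv ZB B" "compact B" "convex B"
    using zonoidE[OF assms(2)] by blast
  obtain W :: "nat \<Rightarrow> (real^3) set" and us where U: "\<And>n. zonotope_of (W n) (us n)" "hconv W (cball 0 1)"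
    using cball_limit_of_zonotopes by blast
  have AB: "\<And>n. zonotope_of (ZA n + ZB n) (as n @ bs n)" "hconv (\<lambda>n. ZA n + ZB n) (A + B)"
    "compact (A + B)" "convex (A + B)"
    using A B by (auto intro: zonotope_of_plus hconv_plus compact_plus convex_set_plus)
  note lims = vol_zonotope_limit[OF A] vol_zonotope_limit[OF AB]
    surface_area_limit[OF A U] surface_area_limit[OF AB U]
  have "surface_area (A + B) * vol A \<le> vol (A + B) * surface_area A"
    using detsum_zvol_le[of "as n" "bs n" "us n" for n]
    by (intro LIMSEQ_le[OF tendsto_mult[OF lims(4,1)] tendsto_mult[OF lims(2,3)]]) auto
  \<comment> \<open>Monotonicity makes \<open>surface_area (A + B)\<close> positive, so the product
    inequality can be divided into the claimed one.\<close>
  moreover have "surface_area A \<le> surface_area (A + B)"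
    by (intro LIMSEQ_le[OF lims(3,4)]) (auto simp: detsum_append detsum_nonneg add.assoc)
  ultimately show ?thesis using assms(3)
    by (simp add: divide_simps mult.commute)
qed

end
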